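(* Assume that $\mu\ll\nu$ and that the POMDP is one step observable. Then the predictor is universally stable weakly a.s.; that is, for every admissible policy $\gamma\in\Gamma$, the predictor is stable in the sense of weak merging with respect to $\gamma$, $P^{\mu,\gamma}$ almost surely: there exists a set of measurement sequences $A\subset\mathcal{Y}^{\mathbb{Z}_+}$ with $P^{\mu,\gamma}$ probability 1 such that for any sequence in $A$, for any $f\in C_b(\mathcal{X})$ and any prior $\nu$ with $\mu\ll\nu$, $$\lim_{n\to\infty}\left|\int f\,d\pi_{n-}^{\mu,\gamma}-\int f\,d\pi_{n-}^{\nu,\gamma}\right|=0 .$$
   Context: Setting (POMDP). $\mathcal{X},\mathcal{Y},\mathcal{U}$ (state, measurement, action spaces) are Polish spaces with their Borel sigma fields; $\mathcal{X}$ is also $\sigma$-compact. $\mathcal{P}(\mathcal{X})$ is the set of Borel probability measures on $\mathcal{X}$ and $C_b(\mathcal{X})$ the set of bounded continuous functions $\mathcal{X}\to\mathbb{R}$. Priors $\mu,\nu$ are elements of $\mathcal{P}(\mathcal{X})$, and $\mu\ll\nu$ means $\mu$ is absolutely continuous with respect to $\nu$. $T(dx'|x,u)$ is a transition kernel from $\mathcal{X}\times\mathcal{U}$ to $\mathcal{X}$, and $Q(dy|x)$ is an observation kernel from $\mathcal{X}$ to $\mathcal{Y}$. An admissible policy $\gamma=\{\gamma_n\}_{n\ge0}$ is a sequence of measurable maps $\gamma_n:\mathcal{Y}^{n+1}\times\mathcal{U}^{n}\to\mathcal{U}$, with actions $U_n=\gamma_n(Y_{[0,n]},U_{[0,n-1]})$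 (so each $U_n$ is a function of $Y_{[0,n]}=(Y_0,\dots,Y_n)$); $\Gamma$ is the set of admissible policies. For a prior $\mu\in\mathcal{P}(\mathcal{X})$ and $\gamma\in\Gamma$, the strategic measure $P^{\mu,\gamma}$ is the law of $(X_n,Y_n)_{n\ge0}$ on $\mathcal{X}^{\mathbb{Z}_+}\times\mathcal{Y}^{\mathbb{Z}_+}$ with $P^{\mu,\gamma}((X_0,Y_0)\in A)=\int_A Q(dy|x)\mu(dx)$ and, for $n\ge1$, $P^{\mu,\gamma}((X_n,Y_n)\in A\mid (X,Y)_{[0,n-1]}=(x,y)_{[0,n-1]})=\int_A Q(dy|x)T(dx|x_{n-1},u_{n-1})$, where $u_{n-1}=\gamma_{n-1}(y_{[0,n-1]},u_{[0,n-2]})$. Predictor: $\pi_{n-}^{\mu,\gamma}(\cdot)=P^{\mu,\gamma}(X_n\in\cdot\mid Y_{[0,n-1]})$, $n\ge1$. Both $\pi_{n-}^{\mu,\gamma}$ and $\pi_{n-}^{\nu,\gamma}$ are evaluated along the same measurement sequence, generated under $P^{\mu,\gamma}$. One step observable (universal in admissible control policies): for every $f\in C_b(\mathcal{X})$ and every $\epsilon>0$ there exists a measurable and bounded function $g:\mathcal{Y}\to\mathbb{R}$ such that $\sup_{x\in\mathcal{X}}\left|f(x)-\int_{\mathcal{Y}}g(y)Q(dy|x)\right|<\epsilon$.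
   Formalization: The prior ν is fixed before the set A, so A may depend on ν (and on the versions of the predictors); a single A of probability 1 serving all priors ν with μ≪ν at once is false in general. *)

theory Defs
  imports "HOL-Probability.Probability"
begin

definition sigma_compact_space :: "'a::topological_space itself \<Rightarrow> bool" where
  "sigma_compact_space _ \<longleftrightarrow>
     (\<exists>K :: nat \<Rightarrow> 'a set. (\<forall>n. compact (K n)) \<and> (\<Union>n. K n) = UNIV)"

text \<open>The values \<open>\<gamma> n\<close> of a policy take the histories \<open>(y\<^sub>0,\<dots>,y\<^sub>n)\<close> and
  \<open>(u\<^sub>0,\<dots>,u\<^sub>n\<^sub>-\<^sub>1)\<close> as extensional functions on \<open>{..n}\<close> and \<open>{..<n}\<close>, i.e. as points of finite
  product spaces.\<close>

type_synonym ('y, 'u) policy = "nat \<Rightarrow> (nat \<Rightarrow> 'y) \<times> (nat \<Rightarrow> 'u) \<Rightarrow> 'u"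

definition admissible :: "('y::topological_space, 'u::topological_space) policy set" where
  "admissible =
     {\<gamma>. \<forall>n. \<gamma> n \<in> (\<Pi>\<^sub>M i\<in>{..n}. borel) \<Otimes>\<^sub>M (\<Pi>\<^sub>M i\<in>{..<n}. borel) \<rightarrow>\<^sub>M borel}"

lemma restrict_fundef_cong [fundef_cong]:
  "I = J \<Longrightarrow> (\<And>i. i \<in> J \<Longrightarrow> f i = g i) \<Longrightarrow> restrict f I = restrict g J"
  by (rule restrict_cong) (auto simp: simp_implies_def)

function action :: "('y, 'u) policy \<Rightarrow> (nat \<Rightarrow> 'y) \<Rightarrow> nat \<Rightarrow> 'u" where
  "action \<gamma> y n = \<gamma> n (restrict y {..n}, \<lambda>k\<in>{..<n}. action \<gamma> y k)"
  by auto
termination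
  by (relation "Wellfounded.measure (\<lambda>(\<gamma>, y, n). n)") auto

declare action.simps [simp del]

text \<open>The law \<open>Q(dy|x) m(dx)\<close> of a state and its measurement when the state has law \<open>m\<close>.\<close>

definition state_obs :: "('x::topological_space \<Rightarrow> 'y::topological_space measure) \<Rightarrow> 'x measure \<Rightarrow>
    ('x \<times> 'y) measure" where
  "state_obs Q m = m \<bind> (\<lambda>x. Q x \<bind> (\<lambda>y. return (borel \<Otimes>\<^sub>M borel) (x, y)))"

text \<open>Conditional law of \<open>(X\<^sub>n, Y\<^sub>n)\<close> given \<open>(X\<^sub>k, Y\<^sub>k) = h k\<close> for \<open>k < n\<close>.\<close>

fun step_kernel ::
  "('x::topological_space \<times> 'u \<Rightarrow> 'x measure) \<Rightarrow> ('x \<Rightarrow> 'y::topological_space measure) \<Rightarrow>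
   'x measure \<Rightarrow> ('y, 'u) policy \<Rightarrow> nat \<Rightarrow> (nat \<Rightarrow> 'x \<times> 'y) \<Rightarrow> ('x \<times> 'y) measure" where
  "step_kernel T Q \<mu> \<gamma> 0 h = state_obs Q \<mu>"
| "step_kernel T Q \<mu> \<gamma> (Suc n) h =
     state_obs Q (T (fst (h n), action \<gamma> (\<lambda>k. snd (h k)) n))"

text \<open>The strategic measure \<open>P\<^bsup>\<mu>,\<gamma>\<^esup>\<close>: the measure on sequences that the Ionescu-Tulcea theorem
  builds from these kernels. A path is a sequence of pairs \<open>(X\<^sub>n, Y\<^sub>n)\<close>.\<close>

definition strategic_measure ::
  "('x::topological_space \<times> 'u \<Rightarrow> 'x measure) \<Rightarrow> ('x \<Rightarrow> 'y::topological_space measure) \<Rightarrow>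
   'x measure \<Rightarrow> ('y, 'u) policy \<Rightarrow> (nat \<Rightarrow> 'x \<times> 'y) measure" where
  "strategic_measure T Q \<mu> \<gamma> =
     projective_family.lim UNIV
       (Ionescu_Tulcea.CI (step_kernel T Q \<mu> \<gamma>) (\<lambda>_. borel \<Otimes>\<^sub>M borel))
       (\<lambda>_. borel \<Otimes>\<^sub>M borel)"

abbreviation state_at :: "nat \<Rightarrow> (nat \<Rightarrow> 'x \<times> 'y) \<Rightarrow> 'x" where
  "state_at n \<omega> \<equiv> fst (\<omega> n)"

abbreviation obs_seq :: "(nat \<Rightarrow> 'x \<times> 'y) \<Rightarrow> nat \<Rightarrow> 'y" where
  "obs_seq \<omega> \<equiv> (\<lambda>k. snd (\<omega> k))"

text \<open>The sigma field generated by \<open>Y\<^sub>0,\<dots>,Y\<^sub>n\<^sub>-\<^sub>1\<close> on the path space.\<close>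

definition past_obs_algebra :: "nat \<Rightarrow> (nat \<Rightarrow> 'x \<times> 'y::topological_space) measure" where
  "past_obs_algebra n =
     vimage_algebra UNIV (\<lambda>\<omega>. restrict (obs_seq \<omega>) {..<n}) (\<Pi>\<^sub>M i\<in>{..<n}. borel)"

text \<open>The hypotheses of the Ionescu-Tulcea theorem hold, so \<open>strategic_measure\<close> is the probability
  measure that it is meant to be.\<close>

lemma measurable_action:
  fixes \<gamma> :: "('y::topological_space, 'u::topological_space) policy"
  assumes "\<gamma> \<in> admissible" and f: "\<And>k. k \<le> n \<Longrightarrow> (\<lambda>h. f h k) \<in> N \<rightarrow>\<^sub>M borel"
  shows "(\<lambda>h. action \<gamma> (f h) n) \<in> N \<rightarrow>\<^sub>M borel"
  using f
proof (induction n rule: less_induct)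
  case (less n)
  have "\<gamma> n \<in> (\<Pi>\<^sub>M i\<in>{..n}. borel) \<Otimes>\<^sub>M (\<Pi>\<^sub>M i\<in>{..<n}. borel) \<rightarrow>\<^sub>M borel"
    using assms(1) by (simp add: admissible_def)
  moreover have "(\<lambda>h. restrict (f h) {..n}) \<in> N \<rightarrow>\<^sub>M (\<Pi>\<^sub>M i\<in>{..n}. borel)"
    using less.prems by (intro measurable_restrict) auto
  moreover have "(\<lambda>h. \<lambda>k\<in>{..<n}. action \<gamma> (f h) k) \<in> N \<rightarrow>\<^sub>M (\<Pi>\<^sub>M i\<in>{..<n}. borel)"
    using less by (intro measurable_restrict) auto
  ultimately show ?case
    by (subst action.simps) (auto intro: measurable_compose[rotated])
qed

lemma measurable_state_obs:
  assumes [measurable]: "Q \<in> borel \<rightarrow>\<^sub>M prob_algebra borel"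
  shows "state_obs Q \<in> prob_algebra borel \<rightarrow>\<^sub>M prob_algebra (borel \<Otimes>\<^sub>M borel)"
proof -
  have *: "(\<lambda>x. Q x \<bind> (\<lambda>y. return (borel \<Otimes>\<^sub>M borel) (x, y))) \<in> borel \<rightarrow>\<^sub>M prob_algebra (borel \<Otimes>\<^sub>M borel)"
    by (rule measurable_bind_prob_space2[where N = borel]) (auto intro!: assms)
  show ?thesis
    unfolding state_obs_def[abs_def]
    by (rule measurable_bind_prob_space[OF _ *]) simp
qed

lemma Ionescu_Tulcea_step_kernel:
  fixes T :: "'x::topological_space \<times> 'u::topological_space \<Rightarrow> 'x measure"
    and Q :: "'x \<Rightarrow> 'y::topological_space measure"
  assumes T: "T \<in> borel \<Otimes>\<^sub>M borel \<rightarrow>\<^sub>M prob_algebra borel"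
    and Q: "Q \<in> borel \<rightarrow>\<^sub>M prob_algebra borel"
    and \<mu>: "\<mu> \<in> space (prob_algebra borel)"
    and \<gamma>: "\<gamma> \<in> admissible"
  shows "Ionescu_Tulcea (step_kernel T Q \<mu> \<gamma>) (\<lambda>_. borel \<Otimes>\<^sub>M borel)"
proof -
  have *: "step_kernel T Q \<mu> \<gamma> n \<in>
    (\<Pi>\<^sub>M i\<in>{0..<n}. borel \<Otimes>\<^sub>M borel) \<rightarrow>\<^sub>M prob_algebra (borel \<Otimes>\<^sub>M borel)" for n
  proof (cases n)
    case 0
    then show ?thesis
      using measurable_space[OF measurable_state_obs[OF Q] \<mu>] by (simp add: step_kernel.simps(1)[abs_def])
  next
    case (Suc m)
    let ?N = "\<Pi>\<^sub>M i\<in>{0..<n}. (borel :: 'x measure) \<Otimes>\<^sub>M (borel :: 'y measure)"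
    have c: "(\<lambda>h. h k) \<in> ?N \<rightarrow>\<^sub>M borel \<Otimes>\<^sub>M borel" if "k \<le> m" for k
      using that Suc by (intro measurable_component_singleton) auto
    have a: "(\<lambda>h. action \<gamma> (\<lambda>k. snd (h k)) m) \<in> ?N \<rightarrow>\<^sub>M borel"
      using c by (intro measurable_action[OF \<gamma>]) (auto intro: measurable_compose[OF _ measurable_snd])
    have x: "(\<lambda>h. fst (h m)) \<in> ?N \<rightarrow>\<^sub>M borel"
      using c by (auto intro: measurable_compose[OF _ measurable_fst])
    have "(\<lambda>h. state_obs Q (T (fst (h m), action \<gamma> (\<lambda>k. snd (h k)) m))) \<in>
        ?N \<rightarrow>\<^sub>M prob_algebra (borel \<Otimes>\<^sub>M borel)"
      by (intro measurable_compose[OF _ measurable_state_obs[OF Q]] measurable_compose[OF _ T]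
        measurable_Pair x a)
    then show ?thesis
      by (simp add: Suc step_kernel.simps(2)[abs_def])
  qed
  show ?thesis
  proof (rule Ionescu_Tulcea.intro)
    show "step_kernel T Q \<mu> \<gamma> i \<in>
      (\<Pi>\<^sub>M i\<in>{0..<i}. borel \<Otimes>\<^sub>M borel) \<rightarrow>\<^sub>M subprob_algebra (borel \<Otimes>\<^sub>M borel)" for i
      using * by (rule measurable_prob_algebraD)
    show "prob_space (step_kernel T Q \<mu> \<gamma> i x)"
      if "x \<in> space (\<Pi>\<^sub>M i\<in>{0..<i}. borel \<Otimes>\<^sub>M borel)" for i x
      using measurable_space[OF * that] by (simp add: space_prob_algebra)
  qed
qed

lemma
  fixes T :: "'x::topological_space \<times> 'u::topological_space \<Rightarrow> 'x measure"
    and Q :: "'x \<Rightarrow> 'y::topological_space measure"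
  assumes T: "T \<in> borel \<Otimes>\<^sub>M borel \<rightarrow>\<^sub>M prob_algebra borel"
    and Q: "Q \<in> borel \<rightarrow>\<^sub>M prob_algebra borel"
    and \<mu>: "\<mu> \<in> space (prob_algebra borel)"
    and \<gamma>: "\<gamma> \<in> admissible"
  shows sets_strategic_measure:
      "sets (strategic_measure T Q \<mu> \<gamma>) = sets (\<Pi>\<^sub>M n\<in>UNIV. borel \<Otimes>\<^sub>M borel)"
    and prob_space_strategic_measure: "prob_space (strategic_measure T Q \<mu> \<gamma>)"
    and subalgebra_past_obs_algebra:
      "subalgebra (strategic_measure T Q \<mu> \<gamma>) (past_obs_algebra n)"
proof -
  interpret Ionescu_Tulcea "step_kernel T Q \<mu> \<gamma>" "\<lambda>_. borel \<Otimes>\<^sub>M borel"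
    using assms by (rule Ionescu_Tulcea_step_kernel)
  show s: "sets (strategic_measure T Q \<mu> \<gamma>) = sets (\<Pi>\<^sub>M n\<in>UNIV. borel \<Otimes>\<^sub>M borel)"
    unfolding strategic_measure_def by simp
  have sp: "space (strategic_measure T Q \<mu> \<gamma>) = UNIV"
    using sets_eq_imp_space_eq[OF s] by (simp add: space_PiM space_pair_measure)
  have p: "prob_space (CI {})"
    by (rule PF.prob_space_P) auto
  have "emeasure PF.lim (PF.emb UNIV {} (space (CI {}))) = 1"
    using prob_space.emeasure_space_1[OF p] by (subst lim) (auto simp: CI_def)
  moreover have "PF.emb UNIV {} (space (CI {})) = space PF.lim"
    by (auto simp: CI_def prod_emb_def space_PiM)
  ultimately show "prob_space (strategic_measure T Q \<mu> \<gamma>)"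
    unfolding strategic_measure_def by (intro prob_spaceI) simp
  have "(\<lambda>\<omega>. restrict (obs_seq \<omega>) {..<n}) \<in>
      strategic_measure T Q \<mu> \<gamma> \<rightarrow>\<^sub>M (\<Pi>\<^sub>M i\<in>{..<n}. borel)"
    unfolding measurable_cong_sets[OF s refl] by measurable
  then show "subalgebra (strategic_measure T Q \<mu> \<gamma>) (past_obs_algebra n)"
    unfolding subalgebra_def past_obs_algebra_def
    using sets_image_in_sets[OF sp] by (simp add: sp)
qed

text \<open>The predictor \<open>P\<^bsup>\<mu>,\<gamma>\<^esup>(X\<^sub>n \<in> \<cdot> | Y\<^sub>0,\<dots>,Y\<^sub>n\<^sub>-\<^sub>1)\<close> is a regular conditional distribution, determined
  only up to a null set of measurement sequences; \<open>predictor T Q \<mu> \<gamma> \<pi>\<close> says that \<open>\<pi>\<close> is a version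
  of it, with \<open>\<pi> n\<close> a kernel evaluated at \<open>(y\<^sub>0,\<dots>,y\<^sub>n\<^sub>-\<^sub>1)\<close>.\<close>

definition predictor ::
  "('x::topological_space \<times> 'u \<Rightarrow> 'x measure) \<Rightarrow> ('x \<Rightarrow> 'y::topological_space measure) \<Rightarrow>
   'x measure \<Rightarrow> ('y, 'u) policy \<Rightarrow> (nat \<Rightarrow> (nat \<Rightarrow> 'y) \<Rightarrow> 'x measure) \<Rightarrow> bool" where
  "predictor T Q \<mu> \<gamma> \<pi> \<longleftrightarrow>
     (\<forall>n\<ge>1. \<pi> n \<in> (\<Pi>\<^sub>M i\<in>{..<n}. borel) \<rightarrow>\<^sub>M prob_algebra borel \<and>
        (\<forall>B\<in>sets borel. AE \<omega> in strategic_measure T Q \<mu> \<gamma>.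
           measure (\<pi> n (restrict (obs_seq \<omega>) {..<n})) B =
           real_cond_exp (strategic_measure T Q \<mu> \<gamma>) (past_obs_algebra n)
             (indicator {\<omega>. state_at n \<omega> \<in> B}) \<omega>))"

definition one_step_observable ::
  "('x::topological_space \<Rightarrow> 'y::topological_space measure) \<Rightarrow> bool" where
  "one_step_observable Q \<longleftrightarrow>
     (\<forall>f :: 'x \<Rightarrow> real. f \<in> bcontfun \<longrightarrow> (\<forall>\<epsilon>>0. \<exists>g :: 'y \<Rightarrow> real.
        g \<in> borel_measurable borel \<and> bounded (range g) \<and>
        (SUP x. ereal \<bar>f x - (\<integral>y. g y \<partial>Q x)\<bar>) < ereal \<epsilon>))"

text \<open>Weak merging, \<open>P\<^bsup>\<mu>,\<gamma>\<^esup>\<close> almost surely, of the predictors started from the priors \<open>\<mu>\<close> and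
  \<open>\<nu>\<close>, whichever versions of them are used. One full set of measurement sequences serves all
  \<open>f\<close>; it may depend on \<open>\<nu>\<close> and on the versions.\<close>

definition predictor_merges_weakly_as ::
  "('x::topological_space \<times> 'u \<Rightarrow> 'x measure) \<Rightarrow> ('x \<Rightarrow> 'y::topological_space measure) \<Rightarrow>
   'x measure \<Rightarrow> 'x measure \<Rightarrow> ('y, 'u) policy \<Rightarrow> bool" where
  "predictor_merges_weakly_as T Q \<mu> \<nu> \<gamma> \<longleftrightarrow>
     (\<forall>\<pi>\<mu> \<pi>\<nu>. predictor T Q \<mu> \<gamma> \<pi>\<mu> \<longrightarrow> predictor T Q \<nu> \<gamma> \<pi>\<nu> \<longrightarrow>
        (\<exists>A\<in>sets (\<Pi>\<^sub>M i\<in>UNIV. borel).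
           measure (distr (strategic_measure T Q \<mu> \<gamma>) (\<Pi>\<^sub>M i\<in>UNIV. borel) obs_seq) A = 1 \<and>
           (\<forall>y\<in>A. \<forall>f :: 'x \<Rightarrow> real. f \<in> bcontfun \<longrightarrow>
              (\<lambda>n. \<bar>(\<integral>x. f x \<partial>\<pi>\<mu> n (restrict y {..<n})) -
                   (\<integral>x. f x \<partial>\<pi>\<nu> n (restrict y {..<n}))\<bar>) \<longlonglongrightarrow> 0)))"

end

theory Submission
  imports Defs
begin

text \<open>
  Let \<open>W\<close> and \<open>V\<close> be the laws of the measurement sequence started from \<open>\<mu>\<close> and \<open>\<nu>\<close>. Since the two
  processes have the same kernels after time \<open>0\<close>, the density of \<open>\<mu>\<close> with respect to \<open>\<nu>\<close>, read off at
  the initial state, is a density of the whole path law (\<open>strategic_measure_density\<close>), so \<open>W \<lless> V\<close>.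
  Integrating the predictor against \<open>Q\<close> gives the conditional law of \<open>Y\<^sub>n\<close> given \<open>Y\<^sub>0,\<dots>,Y\<^sub>n\<^sub>-\<^sub>1\<close>
  (\<open>predictive_obs_law\<close>), and one step observability says that every \<open>f\<close> in \<open>C\<^sub>b\<close> is uniformly close
  to some \<open>x \<mapsto> \<integral>g dQ(x)\<close>. It therefore suffices that the one-step predictive laws \<open>\<kappa>\<^sub>n\<close> and \<open>\<Lambda>\<^sub>n\<close> of
  the measurements under \<open>W\<close> and \<open>V\<close> merge, \<open>W\<close>-almost surely and on one full set for all bounded
  measurable \<open>g\<close>. The exceptional set must not depend on \<open>g\<close>, as \<open>C\<^sub>b\<close> need not be separable; this is
  why the merging is proved in total variation (\<open>AE_predictive_merge\<close>).

  That merging is the one-step case of the Blackwell-Dubins theorem, and it follows from a telescoping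
  sum, without martingale convergence. Let \<open>l\<^sub>n\<close> be the likelihood ratio of the first \<open>n\<close> measurements.
  Given the past, \<open>l\<^sub>n\<^sub>+\<^sub>1 / l\<^sub>n\<close> is a density of \<open>\<kappa>\<^sub>n\<close> with respect to \<open>\<Lambda>\<^sub>n\<close>, and the conditional
  expectation of \<open>sqrt l\<^sub>n\<^sub>+\<^sub>1\<close> under \<open>V\<close> falls short of \<open>sqrt l\<^sub>n\<close> by some \<open>h\<^sub>n \<ge> 0\<close>, where
  \<open>h\<^sub>n / sqrt l\<^sub>n\<close> is half the squared Hellinger distance of \<open>\<kappa>\<^sub>n\<close> and \<open>\<Lambda>\<^sub>n\<close>.
  The \<open>V\<close>-expectations of the \<open>h\<^sub>n\<close> have a finite sum, whence \<open>h\<^sub>n \<rightarrow> 0\<close> almost surely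
  under \<open>V\<close> and so under \<open>W\<close>. On the other hand \<open>inf l\<^sub>n > 0\<close> almost surely under \<open>W\<close>, by a
  maximal inequality for likelihood ratios. So \<open>h\<^sub>n / sqrt l\<^sub>n \<rightarrow> 0\<close>, and the
  Hellinger distance controls the total variation distance (\<open>hellinger_bound\<close>).
\<close>

section \<open>Markov property and densities for Ionescu-Tulcea limits\<close>

lemma (in Ionescu_Tulcea) prob_space_lim: "prob_space PF.lim"
proof -
  have p: "prob_space (CI {})"
    by (rule PF.prob_space_P) auto
  have "prob_space (distr PF.lim (PiM {} M) (\<lambda>x. restrict x {}))"
    by (subst distr_lim) (auto intro: p)
  then show ?thesis
    by (rule prob_space_distrD[rotated])
      (auto simp: measurable_cong_sets[OF PF.sets_lim refl] intro!: measurable_restrict)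
qed

lemma (in Ionescu_Tulcea) distr_lim_initial:
  "distr PF.lim (PiM {0..<n} M) (\<lambda>x. restrict x {0..<n}) = C 0 n (\<lambda>_. undefined)"
proof -
  have "distr PF.lim (PiM {0..<n} M) (\<lambda>x. restrict x {0..<n}) = CI {0..<n}"
    by (rule distr_lim) simp
  also have "\<dots> = C 0 n (\<lambda>_. undefined)"
  proof (rule measure_eqI)
    fix A assume "A \<in> sets (CI {0..<n})"
    then have A: "A \<in> sets (PiM {0..<n} M)" by (simp add: CI_def)
    then show "emeasure (CI {0..<n}) A = emeasure (C 0 n (\<lambda>_. undefined)) A"
      by (subst emeasure_CI[of _ n]) (auto simp: space_PiM prod_emb_id dest!: sets.sets_into_space)
  qed (simp add: CI_def sets_C)
  finally show ?thesis .
qed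

text \<open>The coordinate \<open>n\<close> of the limit has conditional law \<open>P n\<close> given its predecessors, because
  the law of the first \<open>n + 1\<close> coordinates is built by that very step.\<close>

lemma (in Ionescu_Tulcea) nn_integral_lim_step:
  assumes [measurable]: "(\<lambda>(h, z). F h z) \<in> borel_measurable (PiM {0..<n} M \<Otimes>\<^sub>M M n)"
  shows "(\<integral>\<^sup>+\<omega>. F (restrict \<omega> {0..<n}) (\<omega> n) \<partial>PF.lim) =
    (\<integral>\<^sup>+\<omega>. (\<integral>\<^sup>+z. F (restrict \<omega> {0..<n}) z \<partial>P n (restrict \<omega> {0..<n})) \<partial>PF.lim)"
proof -
  note lm = measurable_cong_sets[OF PF.sets_lim refl]
  have r: "(\<lambda>\<omega>. restrict \<omega> {0..<m}) \<in> PF.lim \<rightarrow>\<^sub>M PiM {0..<m} M" for m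
    by (auto simp: lm intro!: measurable_restrict)
  let ?u = "\<lambda>_. undefined"
  have u: "?u \<in> space (PiM {0..<0} M)" by (simp add: space_PiM)
  have sC: "sets (C 0 n ?u) = sets (PiM {0..<n} M)" using sets_C[OF u] by simp
  have mG: "(\<lambda>h. F (restrict h {0..<n}) (h n)) \<in> borel_measurable (PiM {0..<Suc n} M)"
  proof -
    have "(\<lambda>h. restrict h {0..<n}) \<in> PiM {0..<Suc n} M \<rightarrow>\<^sub>M PiM {0..<n} M"
      by (intro measurable_restrict measurable_component_singleton) auto
    moreover have "(\<lambda>h. h n) \<in> PiM {0..<Suc n} M \<rightarrow>\<^sub>M M n"
      by (intro measurable_component_singleton) auto
    ultimately have "(\<lambda>h. (restrict h {0..<n}, h n)) \<in> PiM {0..<Suc n} M \<rightarrow>\<^sub>M PiM {0..<n} M \<Otimes>\<^sub>M M n"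
      by measurable
    from measurable_compose[OF this assms] show ?thesis by simp
  qed
  have mI: "(\<lambda>h. \<integral>\<^sup>+z. F h z \<partial>P n h) \<in> borel_measurable (PiM {0..<n} M)"
    by (rule nn_integral_measurable_subprob_algebra2[OF assms P])
  have "(\<integral>\<^sup>+\<omega>. F (restrict \<omega> {0..<n}) (\<omega> n) \<partial>PF.lim) =
      (\<integral>\<^sup>+h. F (restrict h {0..<n}) (h n) \<partial>distr PF.lim (PiM {0..<Suc n} M) (\<lambda>x. restrict x {0..<Suc n}))"
    using mG r by (subst nn_integral_distr) (auto simp: restrict_restrict intro!: nn_integral_cong arg_cong2[of _ _ _ _ F])
  also have "\<dots> = (\<integral>\<^sup>+h. (\<integral>\<^sup>+h'. F (restrict h' {0..<n}) (h' n) \<partial>eP n h) \<partial>C 0 n ?u)"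
    unfolding distr_lim_initial C.simps
    using measurable_eP[of n] mG
    by (subst nn_integral_bind[where B="PiM {0..<Suc n} M"]) (auto simp: measurable_cong_sets[OF sC refl])
  also have "\<dots> = (\<integral>\<^sup>+h. (\<integral>\<^sup>+z. F h z \<partial>P n h) \<partial>C 0 n ?u)"
  proof (rule nn_integral_cong)
    fix h assume "h \<in> space (C 0 n ?u)"
    then have h: "h \<in> space (PiM {0..<n} M)" using sets_eq_imp_space_eq[OF sC] by simp
    have "restrict (h(n := z)) {0..<n} = h" for z
      using h by (auto simp: space_PiM PiE_def extensional_def restrict_def)
    with h mG show "(\<integral>\<^sup>+h'. F (restrict h' {0..<n}) (h' n) \<partial>eP n h) = (\<integral>\<^sup>+z. F h z \<partial>P n h)"
      by (subst nn_integral_eP) auto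
  qed
  also have "\<dots> = (\<integral>\<^sup>+\<omega>. (\<integral>\<^sup>+z. F (restrict \<omega> {0..<n}) z \<partial>P n (restrict \<omega> {0..<n})) \<partial>PF.lim)"
    unfolding distr_lim_initial[symmetric] using r mI by (subst nn_integral_distr) auto
  finally show ?thesis .
qed

text \<open>Only the initial law differs, so the change of measure at time \<open>0\<close> is carried along unchanged
  by every later kernel. This is proved for the integrals of functions of finitely many
  coordinates, by induction on their number.\<close>

lemma Ionescu_Tulcea_lim_density:
  assumes P: "Ionescu_Tulcea P M" and P': "Ionescu_Tulcea P' M"
    and init: "P 0 (\<lambda>_. undefined) = density (P' 0 (\<lambda>_. undefined)) r"
    and step: "\<And>n h. 0 < n \<Longrightarrow> P n h = P' n h"
    and [measurable]: "r \<in> borel_measurable (M 0)"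
  shows "projective_family.lim UNIV (Ionescu_Tulcea.CI P M) M =
    density (projective_family.lim UNIV (Ionescu_Tulcea.CI P' M) M) (\<lambda>\<omega>. r (\<omega> 0))" (is "?L = density ?L' _")
proof -
  interpret I: Ionescu_Tulcea P M by fact
  interpret I': Ionescu_Tulcea P' M by fact
  have sl: "sets ?L = sets (PiM UNIV M)" "sets ?L' = sets (PiM UNIV M)"
    by simp_all
  note lm = measurable_cong_sets[OF sl(1) refl] measurable_cong_sets[OF sl(2) refl]
  have r0[measurable]: "(\<lambda>\<omega>. r (\<omega> 0)) \<in> borel_measurable (PiM {0..<Suc n} M)" for n
    using measurable_component_singleton[of 0 "{0..<Suc n}" M] by measurable
  have finite_dim: "(\<integral>\<^sup>+\<omega>. F (restrict \<omega> {0..<Suc n}) \<partial>?L) =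
      (\<integral>\<^sup>+\<omega>. r (\<omega> 0) * F (restrict \<omega> {0..<Suc n}) \<partial>?L')"
    if "F \<in> borel_measurable (PiM {0..<Suc n} M)" for F n
    using that
  proof (induction n arbitrary: F)
    case 0
    have res: "restrict \<omega> {0..<Suc 0} = (\<lambda>_. undefined)(0 := \<omega> 0)" for \<omega> :: "nat \<Rightarrow> 'a"
      by (auto simp: restrict_def)
    have "(\<lambda>p. (fst p)(0 := snd p)) \<in> PiM {0..<0} M \<Otimes>\<^sub>M M 0 \<rightarrow>\<^sub>M PiM {0..<Suc 0} M"
      by (rule measurable_fun_upd[where J="{0..<0}"]) auto
    then have mF[measurable]: "(\<lambda>(h, z). F (h(0 := z))) \<in> borel_measurable (PiM {0..<0} M \<Otimes>\<^sub>M M 0)"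
      unfolding split_beta' by (rule measurable_compose[OF _ "0.prems"])
    have mF': "(\<lambda>z. F ((\<lambda>_. undefined)(0 := z))) \<in> borel_measurable (M 0)"
      using measurable_Pair2[OF mF, of "\<lambda>_. undefined"] by (simp add: space_PiM)
    have sP: "sets (P' 0 (\<lambda>_. undefined)) = sets (M 0)"
      by (rule I'.sets_P) (simp add: space_PiM)
    note sP' = measurable_cong_sets[OF sP refl]
    have mH: "(\<lambda>(h, z). r z * F (h(0 := z))) \<in> borel_measurable (PiM {0..<0} M \<Otimes>\<^sub>M M 0)"
      by measurable
    have "(\<integral>\<^sup>+\<omega>. F (restrict \<omega> {0..<Suc 0}) \<partial>?L) =
        (\<integral>\<^sup>+z. F ((\<lambda>_. undefined)(0 := z)) \<partial>P 0 (\<lambda>_. undefined))"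
      unfolding res using I.nn_integral_lim_step[OF mF] prob_space.emeasure_space_1[OF I.prob_space_lim]
      by (simp add: restrict_def)
    also have "\<dots> = (\<integral>\<^sup>+z. r z * F ((\<lambda>_. undefined)(0 := z)) \<partial>P' 0 (\<lambda>_. undefined))"
      unfolding init using mF' by (subst nn_integral_density) (auto simp: sP')
    also have "\<dots> = (\<integral>\<^sup>+\<omega>. r (\<omega> 0) * F (restrict \<omega> {0..<Suc 0}) \<partial>?L')"
      unfolding res using I'.nn_integral_lim_step[OF mH]
        prob_space.emeasure_space_1[OF I'.prob_space_lim]
      by (simp add: restrict_def)
    finally show ?case .
  next
    case (Suc n)
    let ?m = "Suc n"
    have res: "restrict \<omega> {0..<Suc ?m} = (restrict \<omega> {0..<?m})(?m := \<omega> ?m)" for \<omega> :: "nat \<Rightarrow> 'a"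
      by (auto simp: restrict_def)
    have "(\<lambda>p. (fst p)(?m := snd p)) \<in> PiM {0..<?m} M \<Otimes>\<^sub>M M ?m \<rightarrow>\<^sub>M PiM {0..<Suc ?m} M"
      by (rule measurable_fun_upd[where J="{0..<?m}"]) (auto simp: atLeastLessThanSuc)
    then have mF[measurable]: "(\<lambda>(h, z). F (h(?m := z))) \<in> borel_measurable (PiM {0..<?m} M \<Otimes>\<^sub>M M ?m)"
      unfolding split_beta' by (rule measurable_compose[OF _ Suc.prems])
    have mG: "(\<lambda>h. \<integral>\<^sup>+z. F (h(?m := z)) \<partial>P ?m h) \<in> borel_measurable (PiM {0..<?m} M)"
      by (rule nn_integral_measurable_subprob_algebra2[OF mF I.P])
    have mH: "(\<lambda>(h, z). r (h 0) * F (h(?m := z))) \<in> borel_measurable (PiM {0..<?m} M \<Otimes>\<^sub>M M ?m)"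
      by measurable
    have "(\<integral>\<^sup>+\<omega>. F (restrict \<omega> {0..<Suc ?m}) \<partial>?L) =
        (\<integral>\<^sup>+\<omega>. (\<integral>\<^sup>+z. F ((restrict \<omega> {0..<?m})(?m := z)) \<partial>P ?m (restrict \<omega> {0..<?m})) \<partial>?L)"
      unfolding res by (rule I.nn_integral_lim_step[OF mF])
    also have "\<dots> = (\<integral>\<^sup>+\<omega>. r (\<omega> 0) * (\<integral>\<^sup>+z. F ((restrict \<omega> {0..<?m})(?m := z)) \<partial>P ?m (restrict \<omega> {0..<?m})) \<partial>?L')"
      by (rule Suc.IH[OF mG])
    also have "\<dots> = (\<integral>\<^sup>+\<omega>. (\<integral>\<^sup>+z. r (restrict \<omega> {0..<?m} 0) * F ((restrict \<omega> {0..<?m})(?m := z)) \<partial>P' ?m (restrict \<omega> {0..<?m})) \<partial>?L')"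
    proof (rule nn_integral_cong)
      fix \<omega> assume "\<omega> \<in> space ?L'"
      then have h: "restrict \<omega> {0..<?m} \<in> space (PiM {0..<?m} M)"
        using sets_eq_imp_space_eq[OF sl(2)] by (auto simp: space_PiM)
      have "(\<lambda>z. F ((restrict \<omega> {0..<?m})(?m := z))) \<in> borel_measurable (P' ?m (restrict \<omega> {0..<?m}))"
        using measurable_Pair2[OF mF h] by (simp add: measurable_cong_sets[OF I'.sets_P[OF h] refl])
      then show "r (\<omega> 0) * (\<integral>\<^sup>+z. F ((restrict \<omega> {0..<?m})(?m := z)) \<partial>P ?m (restrict \<omega> {0..<?m})) =
          (\<integral>\<^sup>+z. r (restrict \<omega> {0..<?m} 0) * F ((restrict \<omega> {0..<?m})(?m := z)) \<partial>P' ?m (restrict \<omega> {0..<?m}))"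
        by (subst nn_integral_cmult) (auto simp: step)
    qed
    also have "\<dots> = (\<integral>\<^sup>+\<omega>. r (\<omega> 0) * F (restrict \<omega> {0..<Suc ?m}) \<partial>?L')"
      unfolding res using I'.nn_integral_lim_step[OF mH] by simp
    finally show ?case .
  qed
  show ?thesis
  proof (rule measure_eqI_PiM_infinite)
    fix A J assume J: "finite J" "J \<subseteq> UNIV" and A: "\<And>i. i \<in> J \<Longrightarrow> A i \<in> sets (M i)"
    obtain n where "J \<subseteq> {..n}"
      using J(1) by (auto simp: finite_nat_iff_bounded_le)
    then have n: "J \<subseteq> {0..<Suc n}"
      by (simp add: atLeast0LessThan lessThan_Suc_atMost)
    have mB: "prod_emb {0..<Suc n} M J (Pi\<^sub>E J A) \<in> sets (PiM {0..<Suc n} M)"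
      using A J n by (intro measurable_prod_emb) (auto intro!: sets_PiM_I_finite)
    let ?B = "indicator (prod_emb {0..<Suc n} M J (Pi\<^sub>E J A)) :: _ \<Rightarrow> ennreal"
    have ind: "indicator (prod_emb UNIV M J (Pi\<^sub>E J A)) \<omega> = ?B (restrict \<omega> {0..<Suc n})"
      if "\<omega> \<in> space (PiM UNIV M)" for \<omega>
    proof -
      have "restrict (restrict \<omega> {0..<Suc n}) J = restrict \<omega> J"
        using n by (simp add: restrict_restrict Int_absorb1)
      with that show ?thesis
        by (auto simp: indicator_def prod_emb_iff space_PiM)
    qed
    have mE: "prod_emb UNIV M J (Pi\<^sub>E J A) \<in> sets (PiM UNIV M)"
      using A J by (intro measurable_prod_emb) (auto intro!: sets_PiM_I_finite)
    have "emeasure ?L (prod_emb UNIV M J (Pi\<^sub>E J A)) = (\<integral>\<^sup>+\<omega>. indicator (prod_emb UNIV M J (Pi\<^sub>E J A)) \<omega> \<partial>?L)"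
      using mE by (intro nn_integral_indicator[symmetric]) simp
    also have "\<dots> = (\<integral>\<^sup>+\<omega>. ?B (restrict \<omega> {0..<Suc n}) \<partial>?L)"
      by (intro nn_integral_cong ind) (simp add: sets_eq_imp_space_eq[OF sl(1)])
    also have "\<dots> = (\<integral>\<^sup>+\<omega>. r (\<omega> 0) * ?B (restrict \<omega> {0..<Suc n}) \<partial>?L')"
      using mB by (intro finite_dim) auto
    also have "\<dots> = (\<integral>\<^sup>+\<omega>. r (\<omega> 0) * indicator (prod_emb UNIV M J (Pi\<^sub>E J A)) \<omega> \<partial>?L')"
      by (intro nn_integral_cong arg_cong2[where f="(*)"] ind[symmetric] refl) (simp add: sets_eq_imp_space_eq[OF sl(2)])
    also have "\<dots> = emeasure (density ?L' (\<lambda>\<omega>. r (\<omega> 0))) (prod_emb UNIV M J (Pi\<^sub>E J A))"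
      using mE by (intro emeasure_density[symmetric]) (auto simp: lm)
    finally show "emeasure ?L (prod_emb UNIV M J (Pi\<^sub>E J A)) =
      emeasure (density ?L' (\<lambda>\<omega>. r (\<omega> 0))) (prod_emb UNIV M J (Pi\<^sub>E J A))" .
  qed (use I.prob_space_lim in \<open>auto simp: prob_space_def\<close>)
qed

section \<open>Hellinger distance and disintegration of densities\<close>

lemma countable_Int_stable_borel_generator:
  obtains E :: "'a::second_countable_topology set set"
  where "countable E" "Int_stable E" "UNIV \<in> E" "sets borel = sigma_sets UNIV E"
proof -
  obtain B :: "'a set set" where B: "countable B" "topological_basis B"
    using ex_countable_basis by blast
  define E where "E = Inter ` {F. finite F \<and> F \<subseteq> B}"
  have "countable E"
    unfolding E_def by (intro countable_image countable_Collect_finite_subset B)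
  moreover have "Int_stable E"
  proof (rule Int_stableI)
    fix a b assume "a \<in> E" "b \<in> E"
    then obtain F G where "finite F" "F \<subseteq> B" "a = \<Inter>F" "finite G" "G \<subseteq> B" "b = \<Inter>G"
      by (auto simp: E_def)
    then show "a \<inter> b \<in> E"
      unfolding E_def by (intro image_eqI[of _ _ "F \<union> G"]) auto
  qed
  moreover have "UNIV \<in> E"
    unfolding E_def by (intro image_eqI[of _ _ "{}"]) auto
  moreover have "sets borel = sigma_sets UNIV E"
  proof
    have "B \<subseteq> E"
      unfolding E_def by (auto intro!: image_eqI[of _ _ "{b}" for b])
    have "sets borel = sigma_sets UNIV B"
      unfolding borel_eq_countable_basis[OF B] by (intro sets_measure_of) auto
    also have "\<dots> \<subseteq> sigma_sets UNIV E"
      by (rule sigma_sets_mono') fact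
    finally show "sets borel \<subseteq> sigma_sets UNIV E" .
    have "open e" if "e \<in> E" for e
      using that B(2) unfolding E_def by (auto intro!: open_Inter dest: topological_basis_open)
    then show "sigma_sets UNIV E \<subseteq> sets borel"
      by (intro sets.sigma_sets_subset[of _ borel, simplified space_borel]) auto
  qed
  ultimately show ?thesis
    using that by blast
qed

text \<open>An identity of disintegrated measures holds fibrewise. For one set \<open>B\<close> this is the uniqueness of
  densities; a countable generator of the Borel sets makes the null set independent of \<open>B\<close>.
  The kernels are prescribed versions, so this is needed to compare them at almost every past.\<close>

lemma AE_kernel_density:
  fixes \<kappa> \<Lambda> :: "'a \<Rightarrow> 'y::second_countable_topology measure"
    and l :: "'a \<Rightarrow> real" and j :: "'a \<Rightarrow> 'y \<Rightarrow> ennreal"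
  assumes "sigma_finite_measure N"
    and \<kappa>: "\<kappa> \<in> N \<rightarrow>\<^sub>M prob_algebra borel" and \<Lambda>: "\<Lambda> \<in> N \<rightarrow>\<^sub>M prob_algebra borel"
    and [measurable]: "l \<in> borel_measurable N"
    and [measurable]: "(\<lambda>(x, z). j x z) \<in> borel_measurable (N \<Otimes>\<^sub>M borel)"
    and eq: "\<And>A B. A \<in> sets N \<Longrightarrow> B \<in> sets borel \<Longrightarrow>
      (\<integral>\<^sup>+x. indicator A x * (\<integral>\<^sup>+z. j x z * indicator B z \<partial>\<Lambda> x) \<partial>N) =
      (\<integral>\<^sup>+x. indicator A x * (ennreal (l x) * emeasure (\<kappa> x) B) \<partial>N)"
  shows "AE x in N. \<forall>B\<in>sets borel. (\<integral>\<^sup>+z. j x z * indicator B z \<partial>\<Lambda> x) = ennreal (l x) * emeasure (\<kappa> x) B"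
proof -
  interpret sigma_finite_measure N by fact
  obtain E :: "'y set set" where E: "countable E" "Int_stable E" "UNIV \<in> E" "sets borel = sigma_sets UNIV E"
    by (rule countable_Int_stable_borel_generator)
  note [measurable] = measurable_prob_algebraD[OF \<kappa>] measurable_prob_algebraD[OF \<Lambda>]
  have "AE x in N. (\<integral>\<^sup>+z. j x z * indicator B z \<partial>\<Lambda> x) = ennreal (l x) * emeasure (\<kappa> x) B"
    if "B \<in> E" for B
  proof (rule density_unique)
    have B[measurable]: "B \<in> sets borel"
      using that E(4) by auto
    show 1: "(\<lambda>x. \<integral>\<^sup>+z. j x z * indicator B z \<partial>\<Lambda> x) \<in> borel_measurable N"
      by (rule nn_integral_measurable_subprob_algebra2[where N=borel]) auto
    show 2: "(\<lambda>x. ennreal (l x) * emeasure (\<kappa> x) B) \<in> borel_measurable N"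
      by measurable
    show "density N (\<lambda>x. \<integral>\<^sup>+z. j x z * indicator B z \<partial>\<Lambda> x) =
        density N (\<lambda>x. ennreal (l x) * emeasure (\<kappa> x) B)"
    proof (rule measure_eqI)
      fix A assume "A \<in> sets (density N (\<lambda>x. \<integral>\<^sup>+z. j x z * indicator B z \<partial>\<Lambda> x))"
      then have A: "A \<in> sets N" by simp
      show "emeasure (density N (\<lambda>x. \<integral>\<^sup>+z. j x z * indicator B z \<partial>\<Lambda> x)) A =
          emeasure (density N (\<lambda>x. ennreal (l x) * emeasure (\<kappa> x) B)) A"
        unfolding emeasure_density[OF 1 A] emeasure_density[OF 2 A]
        using eq[OF A B] by (simp only: mult.commute[of _ "indicator A _"])
    qed simp
  qed
  then have "AE x in N. \<forall>B\<in>E. (\<integral>\<^sup>+z. j x z * indicator B z \<partial>\<Lambda> x) = ennreal (l x) * emeasure (\<kappa> x) B"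
    using E(1) by (simp add: AE_ball_countable)
  with AE_space show ?thesis
  proof eventually_elim
    fix x assume x: "x \<in> space N"
      and *: "\<forall>B\<in>E. (\<integral>\<^sup>+z. j x z * indicator B z \<partial>\<Lambda> x) = ennreal (l x) * emeasure (\<kappa> x) B"
    have sk[measurable_cong]: "sets (\<kappa> x) = sets borel" "sets (\<Lambda> x) = sets borel"
      using measurable_space[OF \<kappa> x] measurable_space[OF \<Lambda> x] by (auto simp: space_prob_algebra)
    interpret k: prob_space "\<kappa> x"
      using measurable_space[OF \<kappa> x] by (auto simp: space_prob_algebra)
    have [measurable]: "j x \<in> borel_measurable borel"
      using x by measurable
    have "density (\<Lambda> x) (j x) = scale_measure (ennreal (l x)) (\<kappa> x)" (is "?A = ?B")
    proof (rule measure_eqI_generator_eq[OF E(2)])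
      show eqE: "emeasure ?A X = emeasure ?B X" if "X \<in> E" for X
      proof -
        have [measurable]: "X \<in> sets borel" using that E(4) by auto
        have "emeasure ?A X = (\<integral>\<^sup>+z. j x z * indicator X z \<partial>\<Lambda> x)"
          by (rule emeasure_density) (simp_all add: sk measurable_cong_sets[OF sk(2) refl])
        then show ?thesis using that * by simp
      qed
      show "emeasure ?A UNIV \<noteq> \<infinity>" 
        using k.emeasure_space_1 sets_eq_imp_space_eq[OF sk(1)]
        unfolding eqE[OF E(3)] by (simp add: ennreal_mult_eq_top_iff)
    qed (use E(3,4) in \<open>auto simp: sk\<close>)
    then have *: "emeasure ?A B = emeasure ?B B" for B
      by simp
    show "\<forall>B\<in>sets borel. (\<integral>\<^sup>+z. j x z * indicator B z \<partial>\<Lambda> x) = ennreal (l x) * emeasure (\<kappa> x) B"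
    proof
      fix B :: "'y set" assume "B \<in> sets borel"
      then have "emeasure ?A B = (\<integral>\<^sup>+z. j x z * indicator B z \<partial>\<Lambda> x)"
        by (intro emeasure_density) (simp_all add: sk measurable_cong_sets[OF sk(2) refl])
      then show "(\<integral>\<^sup>+z. j x z * indicator B z \<partial>\<Lambda> x) = ennreal (l x) * emeasure (\<kappa> x) B"
        using *[of B] by simp
    qed
  qed
qed

text \<open>Jensen's inequality for the square root, obtained from the variance of \<open>sqrt j\<close> being nonnegative.\<close>

lemma sqrt_integral_le:
  fixes j :: "'z \<Rightarrow> real"
  assumes "prob_space L" and [measurable]: "j \<in> borel_measurable L" and nn: "\<And>z. 0 \<le> j z" and l: "0 \<le> l"
    and tot: "(\<integral>\<^sup>+z. ennreal (j z) \<partial>L) = ennreal l"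
  shows "integrable L (\<lambda>z. sqrt (j z))" "(\<integral>z. sqrt (j z) \<partial>L) \<le> sqrt l"
proof -
  interpret prob_space L by fact
  have ij: "integrable L j"
    using tot nn by (intro integrableI_nonneg) auto
  have Ij: "(\<integral>z. j z \<partial>L) = l"
    using tot nn l by (subst integral_eq_nn_integral) auto
  have ineq: "sqrt (j z) \<le> (1 + j z) / 2" for z
    using arith_geo_mean_sqrt[of 1 "j z"] nn by simp
  show isj: "integrable L (\<lambda>z. sqrt (j z))"
    by (rule Bochner_Integration.integrable_bound[of L "\<lambda>z. (1 + j z) / 2"])
       (use ij ineq nn in \<open>auto intro!: AE_I2 order_trans[OF ineq]\<close>)
  have "(\<integral>z. sqrt (j z) \<partial>L)\<^sup>2 \<le> l"
  proof -
    have "0 \<le> (\<integral>z. (sqrt (j z) - (\<integral>z. sqrt (j z) \<partial>L))\<^sup>2 \<partial>L)"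
      by (rule Bochner_Integration.integral_nonneg) simp
    also have "\<dots> = l - (\<integral>z. sqrt (j z) \<partial>L)\<^sup>2"
      using isj ij nn Ij by (subst variance_eq) auto
    finally show ?thesis by simp
  qed
  then show "(\<integral>z. sqrt (j z) \<partial>L) \<le> sqrt l"
    by (rule real_le_rsqrt)
qed

text \<open>With \<open>r = j / l\<close> the density of \<open>K\<close> with respect to \<open>L\<close>, the quantity
  \<open>(sqrt l - \<integral>sqrt j dL) / sqrt l = 1 - \<integral>sqrt r dL\<close> is half the squared Hellinger distance of \<open>K\<close> and \<open>L\<close>.
  The factorisation \<open>r - 1 = (sqrt r - 1) (sqrt r + 1)\<close> bounds the total variation; the free
  parameter \<open>d\<close> comes from using Young's inequality for this product in place of Cauchy-Schwarz,
  so a small \<open>d\<close> is fixed first and the Hellinger distance is made small relative to it.\<close>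

lemma hellinger_bound:
  fixes j :: "'z \<Rightarrow> real"
  assumes "prob_space L" "prob_space K" and sets[measurable_cong]: "sets K = sets L"
    and [measurable]: "j \<in> borel_measurable L" "g \<in> borel_measurable L"
    and nn: "\<And>z. 0 \<le> j z" and l: "0 < l" and d: "0 < d"
    and K: "\<And>B. B \<in> sets L \<Longrightarrow> (\<integral>\<^sup>+z. ennreal (j z) * indicator B z \<partial>L) = ennreal l * emeasure K B"
    and g: "\<And>z. \<bar>g z\<bar> \<le> C"
  shows "\<bar>(\<integral>z. g z \<partial>K) - (\<integral>z. g z \<partial>L)\<bar> \<le> C * ((sqrt l - (\<integral>z. sqrt (j z) \<partial>L)) / sqrt l / d + 2 * d)"
proof -
  interpret L: prob_space L by fact
  interpret K: prob_space K by fact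
  have C: "0 \<le> C"
    using g[of undefined] by (auto intro: order_trans)
  have tot: "(\<integral>\<^sup>+z. ennreal (j z) \<partial>L) = ennreal l"
    using K[OF sets.top] K.emeasure_space_1 sets_eq_imp_space_eq[OF sets]
    by (auto cong: nn_integral_cong)
  have ij: "integrable L j"
    using tot nn by (intro integrableI_nonneg) auto
  have Ij: "(\<integral>z. j z \<partial>L) = l"
    using tot nn l by (subst integral_eq_nn_integral) auto
  note isj = sqrt_integral_le(1)[OF \<open>prob_space L\<close> _ nn _ tot]
  define r where "r z = j z / l" for z
  have r[measurable]: "r \<in> borel_measurable L"
    unfolding r_def by measurable
  have rnn: "0 \<le> r z" for z
    using nn l by (simp add: r_def)
  have ir: "integrable L r" "(\<integral>z. r z \<partial>L) = 1"
    using ij Ij l by (auto simp: r_def[abs_def])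
  have isr: "integrable L (\<lambda>z. sqrt (r z))" "(\<integral>z. sqrt (r z) \<partial>L) = (\<integral>z. sqrt (j z) \<partial>L) / sqrt l"
    using isj l by (auto simp: r_def[abs_def] real_sqrt_divide)
  have "K = density L r"
  proof (rule measure_eqI)
    fix B assume "B \<in> sets K"
    then have [measurable]: "B \<in> sets L" by (simp add: sets)
    have "emeasure (density L r) B = (\<integral>\<^sup>+z. ennreal (1 / l) * (ennreal (j z) * indicator B z) \<partial>L)"
      using nn l by (auto simp: emeasure_density r_def ennreal_mult''[symmetric] indicator_def intro!: nn_integral_cong)
    also have "\<dots> = ennreal (1 / l) * (ennreal l * emeasure K B)"
      by (subst nn_integral_cmult) (auto simp: K)
    also have "\<dots> = emeasure K B"
      using l by (simp add: mult.assoc[symmetric] ennreal_mult''[symmetric])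
    finally show "emeasure K B = emeasure (density L r) B" by simp
  qed (simp add: sets)
  then have gK: "(\<integral>z. g z \<partial>K) = (\<integral>z. r z * g z \<partial>L)"
    using rnn by (simp add: integral_real_density)
  have ig: "integrable L g"
    using g by (intro L.integrable_const_bound[of _ C]) auto
  have irg: "integrable L (\<lambda>z. r z * g z)"
  proof (rule Bochner_Integration.integrable_bound[of L "\<lambda>z. C * r z"])
    show "AE z in L. norm (r z * g z) \<le> norm (C * r z)"
      using g rnn C by (auto simp: abs_mult mult.commute[of C] intro!: mult_left_mono AE_I2)
  qed (use ir in auto)
  have pt: "\<bar>r z * g z - g z\<bar> \<le> C * ((r z + 1 - 2 * sqrt (r z)) / (2 * d) + d * (r z + 1))" for z
  proof -
    define s where "s = sqrt (r z)"
    have s: "0 \<le> s" "r z = s\<^sup>2" using rnn by (auto simp: s_def)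
    \<comment> \<open>Young's inequality with weight \<open>d\<close>, from the square of \<open>\<bar>s - 1\<bar> - d * (s + 1)\<close>.\<close>
    have 1: "\<bar>s - 1\<bar> * (s + 1) \<le> (s - 1)\<^sup>2 / (2 * d) + d * (s + 1)\<^sup>2 / 2"
    proof -
      have "0 \<le> (\<bar>s - 1\<bar> - d * (s + 1))\<^sup>2 / (2 * d)" using d by simp
      also have "\<dots> = (s - 1)\<^sup>2 / (2 * d) + d * (s + 1)\<^sup>2 / 2 - \<bar>s - 1\<bar> * (s + 1)"
      proof -
        have "(\<bar>s - 1\<bar> - d * (s + 1))\<^sup>2 = (s - 1)\<^sup>2 - 2 * d * (\<bar>s - 1\<bar> * (s + 1)) + d\<^sup>2 * (s + 1)\<^sup>2"
          by (simp add: power2_diff power_mult_distrib)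
        then show ?thesis using d by (simp add: field_simps power2_eq_square)
      qed
      finally show ?thesis by simp
    qed
    have 2: "(s + 1)\<^sup>2 \<le> 2 * (s\<^sup>2 + 1)"
      using zero_le_power2[of "s - 1"] unfolding power2_sum power2_diff by simp
    have "\<bar>r z - 1\<bar> = \<bar>s - 1\<bar> * (s + 1)"
    proof -
      have "\<bar>r z - 1\<bar> = \<bar>(s - 1) * (s + 1)\<bar>"
        using s by (simp add: power2_eq_square algebra_simps)
      then show ?thesis using s by (simp add: abs_mult)
    qed
    also have "\<dots> \<le> (s - 1)\<^sup>2 / (2 * d) + d * (s\<^sup>2 + 1)"
      using 1 mult_left_mono[OF 2, of "d / 2"] d by (simp add: algebra_simps)
    also have "\<dots> = (r z + 1 - 2 * sqrt (r z)) / (2 * d) + d * (r z + 1)"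
      using s by (simp add: power2_diff s_def[symmetric])
    finally have *: "\<bar>r z - 1\<bar> \<le> (r z + 1 - 2 * sqrt (r z)) / (2 * d) + d * (r z + 1)" .
    have "\<bar>r z * g z - g z\<bar> = \<bar>g z\<bar> * \<bar>r z - 1\<bar>"
      by (simp add: abs_mult[symmetric] algebra_simps)
    also have "\<dots> \<le> C * ((r z + 1 - 2 * sqrt (r z)) / (2 * d) + d * (r z + 1))"
      using * g C by (intro mult_mono) auto
    finally show ?thesis .
  qed
  have "\<bar>(\<integral>z. g z \<partial>K) - (\<integral>z. g z \<partial>L)\<bar> = \<bar>\<integral>z. r z * g z - g z \<partial>L\<bar>"
    using ig irg by (simp add: gK)
  also have "\<dots> \<le> (\<integral>z. \<bar>r z * g z - g z\<bar> \<partial>L)"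
    by (rule integral_abs_bound)
  also have "\<dots> \<le> (\<integral>z. C * ((r z + 1 - 2 * sqrt (r z)) / (2 * d) + d * (r z + 1)) \<partial>L)"
    using ig irg ir isr by (intro integral_mono pt) auto
  also have "\<dots> = C * ((2 - 2 * (\<integral>z. sqrt (r z) \<partial>L)) / (2 * d) + d * 2)"
    using ir isr by (simp add: L.prob_space)
  also have "\<dots> = C * ((sqrt l - (\<integral>z. sqrt (j z) \<partial>L)) / sqrt l / d + 2 * d)"
    using l d by (simp add: isr(2) field_simps)
  finally show ?thesis .
qed

section \<open>Merging of one-step predictive laws\<close>

abbreviation past :: "nat \<Rightarrow> (nat \<Rightarrow> 'a) \<Rightarrow> nat \<Rightarrow> 'a" where
  "past n y \<equiv> restrict y {..<n}"

abbreviation past_space :: "nat \<Rightarrow> (nat \<Rightarrow> 'y::topological_space) measure" where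
  "past_space n \<equiv> \<Pi>\<^sub>M i\<in>{..<n}. borel"

text \<open>From time \<open>n\<^sub>0\<close> on, \<open>\<kappa> n\<close> is a regular conditional law of the coordinate \<open>n\<close> given the earlier
  ones. The start \<open>n\<^sub>0\<close> is free because predictors are specified from time \<open>1\<close> on.
  Testing with functions of the past and the present jointly, rather than with rectangles, lets
  both likelihood ratios and their square roots be disintegrated directly.\<close>

definition predictive :: "nat \<Rightarrow> (nat \<Rightarrow> 'y::topological_space) measure \<Rightarrow>
    (nat \<Rightarrow> (nat \<Rightarrow> 'y) \<Rightarrow> 'y measure) \<Rightarrow> bool" where
  "predictive n\<^sub>0 W \<kappa> \<longleftrightarrow> (\<forall>n\<ge>n\<^sub>0. \<kappa> n \<in> past_space n \<rightarrow>\<^sub>M prob_algebra borel \<and>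
     (\<forall>F. (\<lambda>(h, z). F h z) \<in> borel_measurable (past_space n \<Otimes>\<^sub>M borel) \<longrightarrow>
        (\<integral>\<^sup>+y. F (past n y) (y n) \<partial>W) = (\<integral>\<^sup>+y. (\<integral>\<^sup>+z. F (past n y) z \<partial>\<kappa> n (past n y)) \<partial>W)))"

lemma past_Suc: "past (Suc n) y = (past n y)(n := y n)"
  by (auto simp: restrict_def)

lemma past_past: "m \<le> n \<Longrightarrow> past m (past n y) = past m y"
  by (auto simp: restrict_def)

lemma past_in_space: "past n y \<in> space (past_space n)"
  by (auto simp: space_PiM)

lemma measurable_past_append:
  "(\<lambda>(h, z). h(n := z)) \<in> past_space n \<Otimes>\<^sub>M borel \<rightarrow>\<^sub>M past_space (Suc n)"
  unfolding split_beta' by (rule measurable_fun_upd[where J="{..<n}"]) auto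

locale predictive_pair =
  fixes W V :: "(nat \<Rightarrow> 'y::second_countable_topology) measure"
    and \<kappa> \<Lambda> :: "nat \<Rightarrow> (nat \<Rightarrow> 'y) \<Rightarrow> 'y measure" and n\<^sub>0 :: nat
  assumes W: "prob_space W" "sets W = sets (\<Pi>\<^sub>M i\<in>UNIV. borel)"
    and V: "prob_space V" "sets V = sets (\<Pi>\<^sub>M i\<in>UNIV. borel)"
    and ac: "absolutely_continuous V W"
    and pred_W: "predictive n\<^sub>0 W \<kappa>" and pred_V: "predictive n\<^sub>0 V \<Lambda>"
begin

sublocale W: prob_space W by (fact W)
sublocale V: prob_space V by (fact V)

lemmas [measurable_cong] = W(2) V(2)

text \<open>The likelihood ratio of the first \<open>n\<close> coordinates, made real valued so that square roots are
  available; the Radon-Nikodym derivative is finite almost everywhere.\<close>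

definition likelihood :: "nat \<Rightarrow> (nat \<Rightarrow> 'y) \<Rightarrow> real" where
  "likelihood n h = enn2real (RN_deriv (distr V (past_space n) (past n)) (distr W (past_space n) (past n)) h)"

lemma measurable_past_WV:
  "past n \<in> W \<rightarrow>\<^sub>M past_space n" "past n \<in> V \<rightarrow>\<^sub>M past_space n"
  by (auto simp: measurable_cong_sets[OF W(2) refl] measurable_cong_sets[OF V(2) refl]
      intro!: measurable_restrict measurable_component_singleton)

lemma measurable_coord_WV:
  "(\<lambda>y. y n) \<in> W \<rightarrow>\<^sub>M borel" "(\<lambda>y. y n) \<in> V \<rightarrow>\<^sub>M borel"
  by (auto simp: measurable_cong_sets[OF W(2) refl] measurable_cong_sets[OF V(2) refl]
      intro!: measurable_component_singleton)

lemmas [measurable] = measurable_past_WV measurable_coord_WV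

lemma measurable_likelihood[measurable]: "likelihood n \<in> borel_measurable (past_space n)"
proof -
  have "likelihood n \<in> borel_measurable (distr V (past_space n) (past n))"
    unfolding likelihood_def[abs_def] by measurable
  then show ?thesis by simp
qed

lemma likelihood_nonneg: "0 \<le> likelihood n h"
  by (simp add: likelihood_def)

lemma nn_integral_likelihood:
  assumes [measurable]: "F \<in> borel_measurable (past_space n)"
  shows "(\<integral>\<^sup>+y. F (past n y) \<partial>W) = (\<integral>\<^sup>+y. ennreal (likelihood n (past n y)) * F (past n y) \<partial>V)"
proof -
  let ?N = "distr V (past_space n) (past n)" and ?M = "distr W (past_space n) (past n)"
  interpret N: prob_space ?N by (rule V.prob_space_distr) measurable
  interpret M: prob_space ?M by (rule W.prob_space_distr) measurable
  have ac': "absolutely_continuous ?N ?M"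
    unfolding absolutely_continuous_def
  proof
    fix A assume "A \<in> null_sets ?N"
    then have A: "A \<in> sets (past_space n)" "past n -` A \<inter> space V \<in> null_sets V"
      by (auto simp: null_sets_distr_iff)
    moreover have "space W = space V"
      using W(2) V(2) by (metis sets_eq_imp_space_eq)
    ultimately show "A \<in> null_sets ?M"
      using ac by (auto simp: null_sets_distr_iff absolutely_continuous_def)
  qed
  have fin: "AE h in ?N. RN_deriv ?N ?M h \<noteq> \<infinity>"
    by (rule N.RN_deriv_finite) (use ac' in \<open>auto intro: M.sigma_finite_measure_axioms\<close>)
  have "(\<integral>\<^sup>+y. F (past n y) \<partial>W) = (\<integral>\<^sup>+h. F h \<partial>?M)"
    by (subst nn_integral_distr) auto
  also have "\<dots> = (\<integral>\<^sup>+h. RN_deriv ?N ?M h * F h \<partial>?N)"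
    by (rule N.RN_deriv_nn_integral) (use ac' in auto)
  also have "\<dots> = (\<integral>\<^sup>+h. ennreal (likelihood n h) * F h \<partial>?N)"
    using fin by (intro nn_integral_cong_AE) (auto simp: likelihood_def less_top)
  also have "\<dots> = (\<integral>\<^sup>+y. ennreal (likelihood n (past n y)) * F (past n y) \<partial>V)"
    by (subst nn_integral_distr) auto
  finally show ?thesis .
qed

lemma measurable_likelihood_append[measurable]:
  "(\<lambda>(h, z). likelihood (Suc n) (h(n := z))) \<in> borel_measurable (past_space n \<Otimes>\<^sub>M borel)"
  using measurable_compose[OF measurable_past_append measurable_likelihood] by (simp add: split_beta')

lemma \<kappa>: "n\<^sub>0 \<le> n \<Longrightarrow> \<kappa> n \<in> past_space n \<rightarrow>\<^sub>M prob_algebra borel"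
  and \<Lambda>: "n\<^sub>0 \<le> n \<Longrightarrow> \<Lambda> n \<in> past_space n \<rightarrow>\<^sub>M prob_algebra borel"
  using pred_W pred_V by (auto simp: predictive_def)

lemma kernel_props:
  assumes "n\<^sub>0 \<le> n"
  shows "prob_space (\<kappa> n (past n y))" "prob_space (\<Lambda> n (past n y))"
    "sets (\<kappa> n (past n y)) = sets borel" "sets (\<Lambda> n (past n y)) = sets borel"
proof -
  from measurable_space[OF \<kappa>[OF assms] past_in_space] measurable_space[OF \<Lambda>[OF assms] past_in_space]
  show "prob_space (\<kappa> n (past n y))" "prob_space (\<Lambda> n (past n y))"
    "sets (\<kappa> n (past n y)) = sets borel" "sets (\<Lambda> n (past n y)) = sets borel"
    by (auto simp: space_prob_algebra)
qed

lemma
  assumes "n\<^sub>0 \<le> n" "(\<lambda>(h, z). F h z) \<in> borel_measurable (past_space n \<Otimes>\<^sub>M borel)"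
  shows nn_integral_pred_W: "(\<integral>\<^sup>+y. F (past n y) (y n) \<partial>W) =
      (\<integral>\<^sup>+y. (\<integral>\<^sup>+z. F (past n y) z \<partial>\<kappa> n (past n y)) \<partial>W)"
    and nn_integral_pred_V: "(\<integral>\<^sup>+y. F (past n y) (y n) \<partial>V) =
      (\<integral>\<^sup>+y. (\<integral>\<^sup>+z. F (past n y) z \<partial>\<Lambda> n (past n y)) \<partial>V)"
  using assms pred_W pred_V by (auto simp: predictive_def)

lemma measurable_likelihood_kernel:
  assumes "n\<^sub>0 \<le> n"
  shows "(\<lambda>z. likelihood (Suc n) ((past n y)(n := z))) \<in> borel_measurable (\<Lambda> n (past n y))"
proof -
  from measurable_Pair2[OF measurable_likelihood_append past_in_space]
  show ?thesis by (simp add: measurable_cong_sets[OF kernel_props(4)[OF assms] refl])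
qed

text \<open>Given the past, \<open>likelihood (Suc n) / likelihood n\<close> is a density of \<open>\<kappa> n\<close> with respect to \<open>\<Lambda> n\<close>: both sides,
  integrated over past events \<open>A\<close> against \<open>V\<close>, give the \<open>W\<close>-probability that the past lies in \<open>A\<close>
  and the next coordinate in \<open>B\<close>. The form without a quotient avoids the zeros of \<open>likelihood n\<close>.\<close>

lemma AE_likelihood_disintegrates:
  assumes n: "n\<^sub>0 \<le> n"
  shows "AE y in V. \<forall>B\<in>sets borel.
    (\<integral>\<^sup>+z. ennreal (likelihood (Suc n) ((past n y)(n := z))) * indicator B z \<partial>\<Lambda> n (past n y)) =
    ennreal (likelihood n (past n y)) * emeasure (\<kappa> n (past n y)) B"
proof -
  let ?N = "distr V (past_space n) (past n)"
  note k[measurable] = measurable_prob_algebraD[OF \<kappa>[OF n]] measurable_prob_algebraD[OF \<Lambda>[OF n]]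
  have "AE h in ?N. \<forall>B\<in>sets borel.
    (\<integral>\<^sup>+z. ennreal (likelihood (Suc n) (h(n := z))) * indicator B z \<partial>\<Lambda> n h) = ennreal (likelihood n h) * emeasure (\<kappa> n h) B"
  proof (rule AE_kernel_density)
    show "sigma_finite_measure ?N"
      by (intro prob_space_imp_sigma_finite V.prob_space_distr) measurable
    show "\<kappa> n \<in> ?N \<rightarrow>\<^sub>M prob_algebra borel" "\<Lambda> n \<in> ?N \<rightarrow>\<^sub>M prob_algebra borel"
      using \<kappa>[OF n] \<Lambda>[OF n] by simp_all
    show "(\<lambda>(h, z). ennreal (likelihood (Suc n) (h(n := z)))) \<in> borel_measurable (?N \<Otimes>\<^sub>M borel)"
      by (simp cong: measurable_cong_sets) measurable
    fix A and B :: "'y set" assume "A \<in> sets ?N" "B \<in> sets borel"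
    then have [measurable]: "A \<in> sets (past_space n)" "B \<in> sets borel" by simp_all
    have [measurable]: "(\<lambda>h. \<integral>\<^sup>+z. ennreal (likelihood (Suc n) (h(n := z))) * indicator B z \<partial>\<Lambda> n h) \<in> borel_measurable (past_space n)"
      by (rule nn_integral_measurable_subprob_algebra2[where N=borel]) measurable
    have mL: "(\<lambda>z. ennreal (likelihood (Suc n) ((past n y)(n := z))) * indicator B z) \<in> borel_measurable (\<Lambda> n (past n y))" for y
      using measurable_likelihood_kernel[OF n, of y] by (simp add: measurable_cong_sets[OF kernel_props(4)[OF n] refl])
    have "(\<integral>\<^sup>+h. indicator A h * (\<integral>\<^sup>+z. ennreal (likelihood (Suc n) (h(n := z))) * indicator B z \<partial>\<Lambda> n h) \<partial>?N) =
        (\<integral>\<^sup>+y. indicator A (past n y) *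
          (\<integral>\<^sup>+z. ennreal (likelihood (Suc n) ((past n y)(n := z))) * indicator B z \<partial>\<Lambda> n (past n y)) \<partial>V)"
      by (subst nn_integral_distr) auto
    also have "\<dots> = (\<integral>\<^sup>+y. (\<integral>\<^sup>+z. indicator A (past n y) *
          (ennreal (likelihood (Suc n) ((past n y)(n := z))) * indicator B z) \<partial>\<Lambda> n (past n y)) \<partial>V)"
      by (intro nn_integral_cong nn_integral_cmult[symmetric] mL)
    also have "\<dots> = (\<integral>\<^sup>+y. indicator A (past n y) * (ennreal (likelihood (Suc n) ((past n y)(n := y n))) * indicator B (y n)) \<partial>V)"
      by (rule nn_integral_pred_V[OF n, symmetric]) measurable
    also have "\<dots> = (\<integral>\<^sup>+y. ennreal (likelihood (Suc n) (past (Suc n) y)) *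
        (indicator A (past n (past (Suc n) y)) * indicator B (past (Suc n) y n)) \<partial>V)"
      unfolding past_Suc[symmetric]
    proof (rule nn_integral_cong)
      fix y :: "nat \<Rightarrow> 'y"
      have "past n (past (Suc n) y) = past n y" "past (Suc n) y n = y n"
        by (simp_all add: past_past del: restrict_restrict)
      then show "indicator A (past n y) * (ennreal (likelihood (Suc n) (past (Suc n) y)) * indicator B (y n)) =
          ennreal (likelihood (Suc n) (past (Suc n) y)) *
            (indicator A (past n (past (Suc n) y)) * indicator B (past (Suc n) y n))"
        by (simp only: ac_simps)
    qed
    also have "\<dots> = (\<integral>\<^sup>+y. indicator A (past n (past (Suc n) y)) * indicator B (past (Suc n) y n) \<partial>W)"
    proof (rule nn_integral_likelihood[symmetric])
      have [measurable]: "past n \<in> past_space (Suc n) \<rightarrow>\<^sub>M past_space n" "(\<lambda>h. h n) \<in> past_space (Suc n) \<rightarrow>\<^sub>M borel"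
        by (auto intro!: measurable_restrict measurable_component_singleton)
      show "(\<lambda>h. indicator A (past n h) * indicator B (h n) :: ennreal) \<in> borel_measurable (past_space (Suc n))"
        by measurable
    qed
    also have "\<dots> = (\<integral>\<^sup>+y. indicator A (past n y) * indicator B (y n) \<partial>W)"
      by (intro nn_integral_cong) (simp add: past_past del: restrict_restrict)
    also have "\<dots> = (\<integral>\<^sup>+y. (\<integral>\<^sup>+z. indicator A (past n y) * indicator B z \<partial>\<kappa> n (past n y)) \<partial>W)"
      by (rule nn_integral_pred_W[OF n]) measurable
    also have "\<dots> = (\<integral>\<^sup>+y. indicator A (past n y) * emeasure (\<kappa> n (past n y)) B \<partial>W)"
      by (intro nn_integral_cong nn_integral_cmult_indicator) (simp add: kernel_props[OF n])
    also have "\<dots> = (\<integral>\<^sup>+y. ennreal (likelihood n (past n y)) * (indicator A (past n y) * emeasure (\<kappa> n (past n y)) B) \<partial>V)"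
      by (rule nn_integral_likelihood) measurable
    also have "\<dots> = (\<integral>\<^sup>+h. indicator A h * (ennreal (likelihood n h) * emeasure (\<kappa> n h) B) \<partial>?N)"
      by (subst nn_integral_distr) (auto intro!: nn_integral_cong simp: ac_simps)
    finally show "(\<integral>\<^sup>+h. indicator A h * (\<integral>\<^sup>+z. ennreal (likelihood (Suc n) (h(n := z))) * indicator B z \<partial>\<Lambda> n h) \<partial>?N) =
      (\<integral>\<^sup>+h. indicator A h * (ennreal (likelihood n h) * emeasure (\<kappa> n h) B) \<partial>?N)" .
  qed (simp cong: measurable_cong_sets)
  then show ?thesis
    by (rule AE_distrD[rotated]) measurable
qed

text \<open>The drop in conditional expectation of the supermartingale \<open>sqrt (likelihood n)\<close> at step \<open>n\<close>
  under \<open>V\<close>. Divided by \<open>sqrt (likelihood n)\<close> it is half the squared Hellinger distance between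
  \<open>\<kappa> n\<close> and \<open>\<Lambda> n\<close>.\<close>

definition gap :: "nat \<Rightarrow> (nat \<Rightarrow> 'y) \<Rightarrow> real" where
  "gap n h = sqrt (likelihood n h) - (\<integral>z. sqrt (likelihood (Suc n) (h(n := z))) \<partial>\<Lambda> n h)"

lemma measurable_gap:
  assumes "n\<^sub>0 \<le> n"
  shows "gap n \<in> borel_measurable (past_space n)"
proof -
  note [measurable] = measurable_prob_algebraD[OF \<Lambda>[OF assms]]
  have [measurable]: "(\<lambda>h. \<integral>\<^sup>+z. ennreal (sqrt (likelihood (Suc n) (h(n := z)))) \<partial>\<Lambda> n h) \<in> borel_measurable (past_space n)"
    by (rule nn_integral_measurable_subprob_algebra2[where N=borel]) measurable
  have "(\<lambda>h. \<integral>z. sqrt (likelihood (Suc n) (h(n := z))) \<partial>\<Lambda> n h) \<in> borel_measurable (past_space n) \<longleftrightarrow>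
      (\<lambda>h. enn2real (\<integral>\<^sup>+z. ennreal (sqrt (likelihood (Suc n) (h(n := z)))) \<partial>\<Lambda> n h)) \<in> borel_measurable (past_space n)"
  proof (intro measurable_cong integral_eq_nn_integral)
    fix h :: "nat \<Rightarrow> 'y" assume h: "h \<in> space (past_space n)"
    have "sets (\<Lambda> n h) = sets borel"
      using measurable_space[OF \<Lambda>[OF assms] h] by (simp add: space_prob_algebra)
    moreover have "(\<lambda>z. likelihood (Suc n) (h(n := z))) \<in> borel_measurable borel"
      using measurable_Pair2[OF measurable_likelihood_append h] by simp
    ultimately show "(\<lambda>z. sqrt (likelihood (Suc n) (h(n := z)))) \<in> borel_measurable (\<Lambda> n h)"
      by (simp cong: measurable_cong_sets)
  qed (simp add: likelihood_nonneg)
  then have [measurable]: "(\<lambda>h. \<integral>z. sqrt (likelihood (Suc n) (h(n := z))) \<partial>\<Lambda> n h) \<in> borel_measurable (past_space n)"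
    by simp
  show ?thesis
    unfolding gap_def[abs_def] by measurable
qed

text \<open>At almost every past \<open>likelihood (Suc n)\<close> has integral \<open>likelihood n\<close> against \<open>\<Lambda> n\<close>, as \<open>\<kappa> n\<close> is a
  probability; so Jensen's inequality applies. The identity in \<open>ennreal\<close> is the summand of the
  telescoping below.\<close>

lemma AE_gap:
  assumes n: "n\<^sub>0 \<le> n"
  shows "AE y in V. 0 \<le> gap n (past n y) \<and>
    ennreal (sqrt (likelihood n (past n y))) = ennreal (gap n (past n y)) +
      (\<integral>\<^sup>+z. ennreal (sqrt (likelihood (Suc n) ((past n y)(n := z)))) \<partial>\<Lambda> n (past n y))"
  using AE_likelihood_disintegrates[OF n]
proof eventually_elim
  fix y
  let ?L = "\<Lambda> n (past n y)" and ?j = "\<lambda>z. likelihood (Suc n) ((past n y)(n := z))" and ?l = "likelihood n (past n y)"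
  assume *: "\<forall>B\<in>sets borel. (\<integral>\<^sup>+z. ennreal (?j z) * indicator B z \<partial>?L) =
    ennreal ?l * emeasure (\<kappa> n (past n y)) B"
  have "emeasure (\<kappa> n (past n y)) UNIV = 1"
    using prob_space.emeasure_space_1[OF kernel_props(1)[OF n]] sets_eq_imp_space_eq[OF kernel_props(3)[OF n]]
    by simp
  then have tot: "(\<integral>\<^sup>+z. ennreal (?j z) \<partial>?L) = ennreal ?l"
    using bspec[OF *, of UNIV] by simp
  note s = sqrt_integral_le[OF kernel_props(2)[OF n] measurable_likelihood_kernel[OF n] likelihood_nonneg likelihood_nonneg tot]
  have "(\<integral>\<^sup>+z. ennreal (sqrt (?j z)) \<partial>?L) = ennreal (\<integral>z. sqrt (?j z) \<partial>?L)"
    by (rule nn_integral_eq_integral[OF s(1)]) (simp add: likelihood_nonneg)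
  moreover have "0 \<le> (\<integral>z. sqrt (?j z) \<partial>?L)"
    by (rule Bochner_Integration.integral_nonneg) (simp add: likelihood_nonneg)
  ultimately show "0 \<le> gap n (past n y) \<and>
    ennreal (sqrt ?l) = ennreal (gap n (past n y)) + (\<integral>\<^sup>+z. ennreal (sqrt (?j z)) \<partial>?L)"
    using s(2) by (simp add: gap_def ennreal_plus[symmetric] del: ennreal_plus)
qed

text \<open>The drops telescope, as the predictive property of \<open>\<Lambda>\<close> turns the conditional expectation in
  each of them into the next square root.\<close>

lemma sum_gap:
  "(\<Sum>k<m. \<integral>\<^sup>+y. ennreal (gap (n\<^sub>0 + k) (past (n\<^sub>0 + k) y)) \<partial>V) +
    (\<integral>\<^sup>+y. ennreal (sqrt (likelihood (n\<^sub>0 + m) (past (n\<^sub>0 + m) y))) \<partial>V) =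
    (\<integral>\<^sup>+y. ennreal (sqrt (likelihood n\<^sub>0 (past n\<^sub>0 y))) \<partial>V)"
proof (induction m)
  case (Suc m)
  let ?n = "n\<^sub>0 + m"
  have n: "n\<^sub>0 \<le> ?n" by simp
  note [measurable] = measurable_prob_algebraD[OF \<Lambda>[OF n]] measurable_gap[OF n]
  have [measurable]: "(\<lambda>h. \<integral>\<^sup>+z. ennreal (sqrt (likelihood (Suc ?n) (h(?n := z)))) \<partial>\<Lambda> ?n h) \<in> borel_measurable (past_space ?n)"
    by (rule nn_integral_measurable_subprob_algebra2[where N=borel]) measurable
  have "(\<integral>\<^sup>+y. ennreal (sqrt (likelihood ?n (past ?n y))) \<partial>V) =
      (\<integral>\<^sup>+y. ennreal (gap ?n (past ?n y)) +
        (\<integral>\<^sup>+z. ennreal (sqrt (likelihood (Suc ?n) ((past ?n y)(?n := z)))) \<partial>\<Lambda> ?n (past ?n y)) \<partial>V)"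
    using AE_gap[OF n] by (intro nn_integral_cong_AE) (auto elim: eventually_mono)
  also have "\<dots> = (\<integral>\<^sup>+y. ennreal (gap ?n (past ?n y)) \<partial>V) +
      (\<integral>\<^sup>+y. (\<integral>\<^sup>+z. ennreal (sqrt (likelihood (Suc ?n) ((past ?n y)(?n := z)))) \<partial>\<Lambda> ?n (past ?n y)) \<partial>V)"
    by (rule nn_integral_add) measurable
  also have "(\<integral>\<^sup>+y. (\<integral>\<^sup>+z. ennreal (sqrt (likelihood (Suc ?n) ((past ?n y)(?n := z)))) \<partial>\<Lambda> ?n (past ?n y)) \<partial>V) =
      (\<integral>\<^sup>+y. ennreal (sqrt (likelihood (Suc ?n) ((past ?n y)(?n := y ?n)))) \<partial>V)"
    by (rule nn_integral_pred_V[OF n, symmetric]) measurable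
  finally show ?case
    using Suc.IH unfolding past_Suc[symmetric] by (simp only: sum.lessThan_Suc add_Suc_right add.assoc)
qed simp

text \<open>By telescoping, the nonnegative drops have total expectation at most that of
  \<open>sqrt (likelihood n\<^sub>0)\<close>, which is finite since \<open>sqrt t \<le> 1 + t\<close>.
  So almost surely their sum is finite.\<close>

lemma AE_gap_tendsto_0: "AE y in V. (\<lambda>n. gap n (past n y)) \<longlonglongrightarrow> 0"
proof -
  let ?g = "\<lambda>k y. ennreal (gap (n\<^sub>0 + k) (past (n\<^sub>0 + k) y))"
  have [measurable]: "gap (n\<^sub>0 + k) \<in> borel_measurable (past_space (n\<^sub>0 + k))" for k
    by (rule measurable_gap) simp
  have "(\<integral>\<^sup>+y. ennreal (sqrt (likelihood n\<^sub>0 (past n\<^sub>0 y))) \<partial>V) \<le> (\<integral>\<^sup>+y. 1 + ennreal (likelihood n\<^sub>0 (past n\<^sub>0 y)) * 1 \<partial>V)"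
  proof (rule nn_integral_mono)
    fix y
    have "sqrt (likelihood n\<^sub>0 (past n\<^sub>0 y)) \<le> 1 + likelihood n\<^sub>0 (past n\<^sub>0 y)"
      using arith_geo_mean_sqrt[of 1 "likelihood n\<^sub>0 (past n\<^sub>0 y)"] likelihood_nonneg[of n\<^sub>0 "past n\<^sub>0 y"] by simp
    then have "ennreal (sqrt (likelihood n\<^sub>0 (past n\<^sub>0 y))) \<le> ennreal (1 + likelihood n\<^sub>0 (past n\<^sub>0 y))"
      by (rule ennreal_leI)
    then show "ennreal (sqrt (likelihood n\<^sub>0 (past n\<^sub>0 y))) \<le> 1 + ennreal (likelihood n\<^sub>0 (past n\<^sub>0 y)) * 1"
      by (simp add: likelihood_nonneg)
  qed
  also have "\<dots> = 1 + (\<integral>\<^sup>+y. ennreal (likelihood n\<^sub>0 (past n\<^sub>0 y)) * 1 \<partial>V)"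
    by (subst nn_integral_add) (auto simp: V.emeasure_space_1)
  also have "(\<integral>\<^sup>+y. ennreal (likelihood n\<^sub>0 (past n\<^sub>0 y)) * 1 \<partial>V) = 1"
    using nn_integral_likelihood[of "\<lambda>_. 1" n\<^sub>0] by (simp add: W.emeasure_space_1)
  finally have b: "(\<integral>\<^sup>+y. ennreal (sqrt (likelihood n\<^sub>0 (past n\<^sub>0 y))) \<partial>V) \<le> 2"
    by (simp only: one_add_one)
  have "(\<Sum>k<m. \<integral>\<^sup>+y. ?g k y \<partial>V) \<le> 2" for m
  proof (rule order_trans[OF _ b])
    show "(\<Sum>k<m. \<integral>\<^sup>+y. ?g k y \<partial>V) \<le> (\<integral>\<^sup>+y. ennreal (sqrt (likelihood n\<^sub>0 (past n\<^sub>0 y))) \<partial>V)"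
      unfolding sum_gap[of m, symmetric] by (rule add_increasing2) simp_all
  qed
  then have "(\<Sum>k. \<integral>\<^sup>+y. ?g k y \<partial>V) \<le> 2"
    by (intro suminf_le_const) auto
  then have "(\<integral>\<^sup>+y. (\<Sum>k. ?g k y) \<partial>V) \<le> 2"
    by (subst nn_integral_suminf) auto
  then have "AE y in V. (\<Sum>k. ?g k y) \<noteq> \<infinity>"
    by (intro nn_integral_noteq_infinite) (auto simp: top_unique)
  moreover have "AE y in V. \<forall>k. 0 \<le> gap (n\<^sub>0 + k) (past (n\<^sub>0 + k) y)"
    unfolding AE_all_countable
  proof
    show "AE y in V. 0 \<le> gap (n\<^sub>0 + k) (past (n\<^sub>0 + k) y)" for k
      by (rule eventually_mono[OF AE_gap conjunct1]) simp_all
  qed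
  ultimately show ?thesis
  proof eventually_elim
    fix y assume "(\<Sum>k. ?g k y) \<noteq> \<infinity>" "\<forall>k. 0 \<le> gap (n\<^sub>0 + k) (past (n\<^sub>0 + k) y)"
    then have "summable (\<lambda>k. gap (n\<^sub>0 + k) (past (n\<^sub>0 + k) y))"
      by (intro summable_suminf_not_top) auto
    from summable_LIMSEQ_zero[OF this] have "(\<lambda>k. gap (k + n\<^sub>0) (past (k + n\<^sub>0) y)) \<longlonglongrightarrow> 0"
      by (simp only: add.commute[of n\<^sub>0])
    then show "(\<lambda>n. gap n (past n y)) \<longlonglongrightarrow> 0"
      by (rule LIMSEQ_offset)
  qed
qed

text \<open>A maximal inequality. Split the event according to the first time \<open>n\<close> at which the ratio
  is at most \<open>e\<close>. The part \<open>D n\<close> is an event of the first \<open>n\<close> coordinates, whose law under \<open>W\<close> has on it a density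
  \<open>likelihood n \<le> e\<close> with respect to that under \<open>V\<close>. So \<open>W (D n) \<le> e * V (D n)\<close>; the parts are disjoint.\<close>

lemma emeasure_likelihood_small:
  assumes e: "0 \<le> e"
  shows "emeasure W {y\<in>space W. \<exists>n. likelihood n (past n y) \<le> e} \<le> ennreal e"
proof -
  define H where "H n = {h\<in>space (past_space n). likelihood n h \<le> e \<and> (\<forall>m<n. e < likelihood m (past m h))}" for n
  have [measurable]: "past m \<in> past_space n \<rightarrow>\<^sub>M past_space m" if "m < n" for m n
    using that by (intro measurable_restrict measurable_component_singleton) auto
  have H[measurable]: "H n \<in> sets (past_space n)" for n
    unfolding H_def by measurable
  define D where "D n = {y. past n y \<in> H n}" for n
  have D_eq: "D n = {y. likelihood n (past n y) \<le> e \<and> (\<forall>m<n. e < likelihood m (past m y))}" for n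
    by (auto simp: D_def H_def space_PiM restrict_restrict Int_absorb1)
  have spW: "space W = UNIV" and spV: "space V = UNIV"
    using sets_eq_imp_space_eq[OF W(2)] sets_eq_imp_space_eq[OF V(2)] by (auto simp: space_PiM)
  have DW: "D n \<in> sets W" for n
    using measurable_sets[OF measurable_past_WV(1) H, of n] by (simp add: D_def spW vimage_def)
  have DV: "D n \<in> sets V" for n
    using DW W(2) V(2) by simp
  have "disjoint_family D"
    unfolding disjoint_family_on_def
  proof safe
    fix m n y assume "m \<noteq> n" "y \<in> D m" "y \<in> D n"
    then show "y \<in> {}"
      by (cases m n rule: linorder_cases) (auto simp: D_eq not_le[symmetric])
  qed
  have "{y\<in>space W. \<exists>n. likelihood n (past n y) \<le> e} = (\<Union>n. D n)"
  proof safe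
    fix y n assume "likelihood n (past n y) \<le> e"
    then show "y \<in> (\<Union>n. D n)"
      using exists_least_iff[of "\<lambda>n. likelihood n (past n y) \<le> e"] by (auto simp: D_eq not_le)
  qed (auto simp: D_eq spW)
  then have "emeasure W {y\<in>space W. \<exists>n. likelihood n (past n y) \<le> e} = (\<Sum>n. emeasure W (D n))"
    using DW \<open>disjoint_family D\<close> by (simp add: suminf_emeasure image_subset_iff)
  also have "\<dots> \<le> (\<Sum>n. ennreal e * emeasure V (D n))"
  proof (rule suminf_le)
    fix n
    have D_ind: "indicator (D n) y = (indicator (H n) (past n y) :: ennreal)" for y
      by (simp add: D_def indicator_def)
    have "emeasure W (D n) = (\<integral>\<^sup>+y. indicator (D n) y \<partial>W)"
      using DW by simp
    also have "\<dots> = (\<integral>\<^sup>+y. indicator (H n) (past n y) \<partial>W)"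
      unfolding D_ind ..
    also have "\<dots> = (\<integral>\<^sup>+y. ennreal (likelihood n (past n y)) * indicator (H n) (past n y) \<partial>V)"
      by (rule nn_integral_likelihood) measurable
    also have "\<dots> \<le> (\<integral>\<^sup>+y. ennreal e * indicator (D n) y \<partial>V)"
      unfolding D_ind by (intro nn_integral_mono) (auto simp: H_def indicator_def intro!: ennreal_leI)
    also have "\<dots> = ennreal e * emeasure V (D n)"
      using DV[of n] by (simp add: nn_integral_cmult)
    finally show "emeasure W (D n) \<le> ennreal e * emeasure V (D n)" .
  qed auto
  also have "\<dots> = ennreal e * emeasure V (\<Union>n. D n)"
    using DV \<open>disjoint_family D\<close> by (simp add: suminf_emeasure image_subset_iff)
  also have "\<dots> \<le> ennreal e"
    using mult_left_mono[OF V.emeasure_le_1[of "\<Union>n. D n"], of "ennreal e"] by simp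
  finally show ?thesis .
qed

lemma AE_likelihood_bounded_below: "AE y in W. \<exists>c>0. \<forall>n. c \<le> likelihood n (past n y)"
proof -
  let ?Z = "\<lambda>e::real. {y\<in>space W. \<exists>n. likelihood n (past n y) \<le> e}"
  let ?N = "\<Inter>k::nat. ?Z (1 / Suc k)"
  have Z: "?Z e \<in> sets W" for e
    by measurable
  have "?N \<in> null_sets W"
  proof (rule null_setsI)
    show "?N \<in> sets W"
      by (rule sets.countable_INT'[OF _ _ image_subsetI]) (rule Z | simp)+
    have "emeasure W ?N \<le> 0 + ennreal e" if "0 < e" for e :: real
    proof -
      obtain k where k: "1 / real (Suc k) < e"
        using \<open>0 < e\<close> by (rule nat_approx_posE)
      have "emeasure W ?N \<le> emeasure W (?Z (1 / Suc k))"
        using Z[of "1 / Suc k"] by (rule emeasure_mono[rotated]) (rule INT_lower, rule UNIV_I)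
      also have "\<dots> \<le> ennreal (1 / Suc k)"
        by (rule emeasure_likelihood_small) simp
      also have "\<dots> \<le> 0 + ennreal e"
        using k by (simp add: ennreal_leI)
      finally show ?thesis .
    qed
    then have "emeasure W ?N \<le> 0"
      by (rule ennreal_le_epsilon)
    then show "emeasure W ?N = 0" by simp
  qed
  then show ?thesis
  proof (rule AE_I')
    show "{y\<in>space W. \<not> (\<exists>c>0. \<forall>n. c \<le> likelihood n (past n y))} \<subseteq> ?N"
    proof safe
      fix y k assume "y \<in> space W" and no: "\<not> (\<exists>c>0. \<forall>n. c \<le> likelihood n (past n y))"
      have "(0::real) < 1 / Suc k" by simp
      with no obtain n where "\<not> 1 / Suc k \<le> likelihood n (past n y)" by blast
      then have "likelihood n (past n y) \<le> 1 / Suc k" by linarith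
      then show "\<exists>n. likelihood n (past n y) \<le> 1 / Suc k" ..
    qed
  qed
qed

text \<open>The drops vanish in the limit by \<open>V\<close>-almost sure summability, which absolute continuity transfers
  to \<open>W\<close>; the likelihood ratios stay away from \<open>0\<close> under \<open>W\<close>. So the Hellinger distances of the
  predictive laws tend to \<open>0\<close>, and they bound the difference of the integrals for every \<open>g\<close>.\<close>

theorem AE_predictive_merge:
  "AE y in W. \<forall>g\<in>borel_measurable borel. bounded (range g) \<longrightarrow>
    (\<lambda>n. (\<integral>z. g z \<partial>\<kappa> n (past n y)) - (\<integral>z. g z \<partial>\<Lambda> n (past n y))) \<longlonglongrightarrow> (0::real)"
proof -
  let ?d = "\<lambda>y n. \<forall>B\<in>sets borel.
    (\<integral>\<^sup>+z. ennreal (likelihood (Suc n) ((past n y)(n := z))) * indicator B z \<partial>\<Lambda> n (past n y)) =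
    ennreal (likelihood n (past n y)) * emeasure (\<kappa> n (past n y)) B"
  have "AE y in V. (\<lambda>n. gap n (past n y)) \<longlonglongrightarrow> 0 \<and> (\<forall>n. n\<^sub>0 \<le> n \<longrightarrow> ?d y n)"
    by (intro AE_conjI AE_gap_tendsto_0 AE_all_countable[THEN iffD2] allI AE_impI AE_likelihood_disintegrates)
  then have "AE y in W. (\<lambda>n. gap n (past n y)) \<longlonglongrightarrow> 0 \<and> (\<forall>n. n\<^sub>0 \<le> n \<longrightarrow> ?d y n)"
    by (intro absolutely_continuous_AE[OF _ ac]) (simp_all add: W(2) V(2))
  with AE_likelihood_bounded_below show ?thesis
  proof (eventually_elim, intro ballI impI)
    fix y and g :: "'y \<Rightarrow> real"
    assume "\<exists>c>0. \<forall>n. c \<le> likelihood n (past n y)"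
      and d: "(\<lambda>n. gap n (past n y)) \<longlonglongrightarrow> 0 \<and> (\<forall>n. n\<^sub>0 \<le> n \<longrightarrow> ?d y n)"
      and g[measurable]: "g \<in> borel_measurable borel" and "bounded (range g)"
    then obtain c where c: "0 < c" "\<And>n. c \<le> likelihood n (past n y)" by auto
    obtain C where C: "0 < C" "\<And>z. \<bar>g z\<bar> \<le> C"
      using \<open>bounded (range g)\<close> by (auto simp: bounded_pos)
    let ?D = "\<lambda>n. (\<integral>z. g z \<partial>\<kappa> n (past n y)) - (\<integral>z. g z \<partial>\<Lambda> n (past n y))"
    have bound: "\<bar>?D n\<bar> \<le> C * (\<bar>gap n (past n y)\<bar> / sqrt c / \<delta> + 2 * \<delta>)" if n: "n\<^sub>0 \<le> n" and \<delta>: "0 < \<delta>" for n \<delta>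
    proof -
      have l: "0 < likelihood n (past n y)" using c(1) c(2)[of n] by simp
      note sk = kernel_props[OF n]
      have "\<bar>?D n\<bar> \<le> C * (gap n (past n y) / sqrt (likelihood n (past n y)) / \<delta> + 2 * \<delta>)"
        unfolding gap_def
        using sk d n g
        by (intro hellinger_bound[OF sk(2,1) _ measurable_likelihood_kernel[OF n] _ likelihood_nonneg l \<delta> _ C(2)])
          (auto simp: measurable_cong_sets[OF sk(4) refl])
      also have "\<dots> \<le> C * (\<bar>gap n (past n y)\<bar> / sqrt c / \<delta> + 2 * \<delta>)"
        using C(1) c l \<delta> by (intro mult_left_mono add_right_mono divide_right_mono frac_le) auto
      finally show ?thesis .
    qed
    show "?D \<longlonglongrightarrow> 0"
    proof (rule LIMSEQ_I)
      fix r :: real assume r: "0 < r"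
      \<comment> \<open>The part \<open>2 * C * \<delta>\<close> of the bound that survives in the limit is then \<open>r / 2\<close>.\<close>
      define \<delta> where "\<delta> = r / (4 * C)"
      have \<delta>: "0 < \<delta>" using r C by (simp add: \<delta>_def)
      have "(\<lambda>n. C * (\<bar>gap n (past n y)\<bar> / sqrt c / \<delta> + 2 * \<delta>)) \<longlonglongrightarrow> C * (\<bar>0\<bar> / sqrt c / \<delta> + 2 * \<delta>)"
        using d c \<delta> by (intro tendsto_intros) auto
      moreover have "C * (\<bar>0\<bar> / sqrt c / \<delta> + 2 * \<delta>) < r"
        using C r by (simp add: \<delta>_def)
      ultimately have "eventually (\<lambda>n. C * (\<bar>gap n (past n y)\<bar> / sqrt c / \<delta> + 2 * \<delta>) < r) sequentially"
        by (rule order_tendstoD(2))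
      with eventually_ge_at_top[of n\<^sub>0] have "eventually (\<lambda>n. \<bar>?D n\<bar> < r) sequentially"
        by eventually_elim (use bound[OF _ \<delta>] in \<open>auto intro: le_less_trans\<close>)
      then show "\<exists>no. \<forall>n\<ge>no. norm (?D n - 0) < r"
        by (auto simp: eventually_sequentially)
    qed
  qed
qed

end

section \<open>Predictive laws of the measurements\<close>

text \<open>The rectangles are stable under intersection and generate the product sigma field, so the joint
  law of \<open>X\<close> and \<open>Z\<close> equals the one built from the law of \<open>X\<close> and the kernel \<open>\<kappa>\<close>.\<close>

lemma nn_integral_kernel_from_rectangles:
  assumes "prob_space M" and X[measurable]: "X \<in> M \<rightarrow>\<^sub>M S" and Z[measurable]: "Z \<in> M \<rightarrow>\<^sub>M K"
    and \<kappa>: "\<kappa> \<in> S \<rightarrow>\<^sub>M prob_algebra K"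
    and rect: "\<And>A B. A \<in> sets S \<Longrightarrow> B \<in> sets K \<Longrightarrow>
      emeasure M {\<omega>\<in>space M. X \<omega> \<in> A \<and> Z \<omega> \<in> B} = (\<integral>\<^sup>+\<omega>. indicator A (X \<omega>) * emeasure (\<kappa> (X \<omega>)) B \<partial>M)"
    and F: "(\<lambda>(h, z). F h z) \<in> borel_measurable (S \<Otimes>\<^sub>M K)"
  shows "(\<integral>\<^sup>+\<omega>. F (X \<omega>) (Z \<omega>) \<partial>M) = (\<integral>\<^sup>+\<omega>. (\<integral>\<^sup>+z. F (X \<omega>) z \<partial>\<kappa> (X \<omega>)) \<partial>M)"
proof -
  interpret prob_space M by fact
  let ?J = "distr M (S \<Otimes>\<^sub>M K) (\<lambda>\<omega>. (X \<omega>, Z \<omega>))"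
  let ?k = "\<lambda>\<omega>. distr (\<kappa> (X \<omega>)) (S \<Otimes>\<^sub>M K) (\<lambda>z. (X \<omega>, z))"
  note [measurable] = measurable_prob_algebraD[OF \<kappa>]
  have k: "?k \<in> M \<rightarrow>\<^sub>M subprob_algebra (S \<Otimes>\<^sub>M K)"
    by (rule measurable_distr2[where M=K]) measurable
  have sk: "sets (\<kappa> (X \<omega>)) = sets K" if "\<omega> \<in> space M" for \<omega>
    using measurable_space[OF \<kappa> measurable_space[OF X that]] by (simp add: space_prob_algebra)
  have pair: "(\<lambda>z. (X \<omega>, z)) \<in> \<kappa> (X \<omega>) \<rightarrow>\<^sub>M S \<Otimes>\<^sub>M K" if "\<omega> \<in> space M" for \<omega>
    using measurable_space[OF X that] by (simp add: measurable_cong_sets[OF sk[OF that] refl])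
  have sb: "sets (M \<bind> ?k) = sets (S \<Otimes>\<^sub>M K)"
    by (rule sets_bind) (auto simp: not_empty)
  have "?J = M \<bind> ?k"
  proof (rule measure_eqI_generator_eq[OF Int_stable_pair_measure_generator pair_measure_closed])
    show "sets ?J = sigma_sets (space S \<times> space K) {a \<times> b |a b. a \<in> sets S \<and> b \<in> sets K}"
      "sets (M \<bind> ?k) = sigma_sets (space S \<times> space K) {a \<times> b |a b. a \<in> sets S \<and> b \<in> sets K}"
      using sb by (simp_all add: sets_pair_measure)
    fix C assume "C \<in> {a \<times> b |a b. a \<in> sets S \<and> b \<in> sets K}"
    then obtain A B where C: "C = A \<times> B" and [measurable]: "A \<in> sets S" "B \<in> sets K" by auto
    have "emeasure ?J C = emeasure M {\<omega>\<in>space M. X \<omega> \<in> A \<and> Z \<omega> \<in> B}"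
      by (simp add: C emeasure_distr vimage_def Int_def conj_commute)
    also have "\<dots> = (\<integral>\<^sup>+\<omega>. indicator A (X \<omega>) * emeasure (\<kappa> (X \<omega>)) B \<partial>M)"
      by (rule rect) fact+
    also have "\<dots> = (\<integral>\<^sup>+\<omega>. emeasure (?k \<omega>) C \<partial>M)"
    proof (rule nn_integral_cong)
      fix \<omega> assume \<omega>: "\<omega> \<in> space M"
      have "(\<lambda>z. (X \<omega>, z)) -` (A \<times> B) \<inter> space (\<kappa> (X \<omega>)) = (if X \<omega> \<in> A then B else {})"
        using sets.sets_into_space[OF \<open>B \<in> sets K\<close>] sets_eq_imp_space_eq[OF sk[OF \<omega>]] by auto
      then show "indicator A (X \<omega>) * emeasure (\<kappa> (X \<omega>)) B = emeasure (?k \<omega>) C"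
        by (simp add: C emeasure_distr[OF pair[OF \<omega>]])
    qed
    also have "\<dots> = emeasure (M \<bind> ?k) C"
      by (rule emeasure_bind[OF not_empty k, symmetric]) (simp add: C)
    finally show "emeasure ?J C = emeasure (M \<bind> ?k) C" .
  next
    show "range (\<lambda>_::nat. space S \<times> space K) \<subseteq> {a \<times> b |a b. a \<in> sets S \<and> b \<in> sets K}"
      by auto
    show "emeasure ?J (space S \<times> space K) \<noteq> \<infinity>"
      using prob_space.emeasure_space_1[OF prob_space_distr, of "\<lambda>\<omega>. (X \<omega>, Z \<omega>)" "S \<Otimes>\<^sub>M K"]
      by (simp add: space_pair_measure)
  qed simp
  have "(\<integral>\<^sup>+\<omega>. F (X \<omega>) (Z \<omega>) \<partial>M) = (\<integral>\<^sup>+p. (case p of (h, z) \<Rightarrow> F h z) \<partial>?J)"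
    using F by (subst nn_integral_distr) auto
  also have "\<dots> = (\<integral>\<^sup>+\<omega>. (\<integral>\<^sup>+p. (case p of (h, z) \<Rightarrow> F h z) \<partial>?k \<omega>) \<partial>M)"
    unfolding \<open>?J = M \<bind> ?k\<close> by (rule nn_integral_bind[OF F k])
  also have "\<dots> = (\<integral>\<^sup>+\<omega>. (\<integral>\<^sup>+z. F (X \<omega>) z \<partial>\<kappa> (X \<omega>)) \<partial>M)"
    by (intro nn_integral_cong) (simp add: nn_integral_distr[OF pair] F)
  finally show ?thesis .
qed

lemma nn_integral_state_obs:
  fixes Q :: "'x::topological_space \<Rightarrow> 'y::topological_space measure"
  assumes Q: "Q \<in> borel \<rightarrow>\<^sub>M prob_algebra borel" and m: "m \<in> space (prob_algebra borel)"
    and F: "F \<in> borel_measurable (borel \<Otimes>\<^sub>M borel)"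
  shows "(\<integral>\<^sup>+p. F p \<partial>state_obs Q m) = (\<integral>\<^sup>+x. (\<integral>\<^sup>+y. F (x, y) \<partial>Q x) \<partial>m)"
proof -
  have *: "(\<lambda>x. Q x \<bind> (\<lambda>y. return (borel \<Otimes>\<^sub>M borel) (x, y))) \<in> borel \<rightarrow>\<^sub>M prob_algebra (borel \<Otimes>\<^sub>M borel)"
    by (rule measurable_bind_prob_space2[where N = borel]) (auto intro!: Q)
  have sm: "sets m = sets borel" and sQ: "sets (Q x) = sets borel" for x
    using m measurable_space[OF Q, of x] by (auto simp: space_prob_algebra)
  have k: "(\<lambda>x. Q x \<bind> (\<lambda>y. return (borel \<Otimes>\<^sub>M borel) (x, y))) \<in> m \<rightarrow>\<^sub>M subprob_algebra (borel \<Otimes>\<^sub>M borel)"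
    using measurable_prob_algebraD[OF *] by (simp add: measurable_cong_sets[OF sm refl])
  have r: "(\<lambda>y. return (borel \<Otimes>\<^sub>M borel) (x, y)) \<in> Q x \<rightarrow>\<^sub>M subprob_algebra (borel \<Otimes>\<^sub>M borel)" for x
    by (simp add: measurable_cong_sets[OF sQ refl])
  show ?thesis
    unfolding state_obs_def nn_integral_bind[OF F k] nn_integral_bind[OF F r]
    by (intro nn_integral_cong nn_integral_return F) (simp add: space_pair_measure)
qed

lemma predictor_measurable:
  "predictor T Q \<mu> \<gamma> \<pi> \<Longrightarrow> 1 \<le> n \<Longrightarrow> \<pi> n \<in> past_space n \<rightarrow>\<^sub>M prob_algebra borel"
  by (simp add: predictor_def)

locale controlled_process =
  fixes T :: "'x::topological_space \<times> 'u::topological_space \<Rightarrow> 'x measure"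
    and Q :: "'x \<Rightarrow> 'y::topological_space measure"
    and \<mu> :: "'x measure" and \<gamma> :: "('y, 'u) policy"
  assumes T: "T \<in> borel \<Otimes>\<^sub>M borel \<rightarrow>\<^sub>M prob_algebra borel"
    and Q: "Q \<in> borel \<rightarrow>\<^sub>M prob_algebra borel"
    and \<mu>: "\<mu> \<in> space (prob_algebra borel)"
    and \<gamma>: "\<gamma> \<in> admissible"
begin

abbreviation "P \<equiv> strategic_measure T Q \<mu> \<gamma>"

sublocale IT: Ionescu_Tulcea "step_kernel T Q \<mu> \<gamma>" "\<lambda>_. borel \<Otimes>\<^sub>M borel"
  by (rule Ionescu_Tulcea_step_kernel[OF T Q \<mu> \<gamma>])

sublocale P: prob_space P
  by (rule prob_space_strategic_measure[OF T Q \<mu> \<gamma>])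

lemmas sets_P = sets_strategic_measure[OF T Q \<mu> \<gamma>]

lemma measurable_P:
  "(\<lambda>\<omega>. \<omega> n) \<in> P \<rightarrow>\<^sub>M borel \<Otimes>\<^sub>M borel" "state_at n \<in> P \<rightarrow>\<^sub>M borel"
  "(\<lambda>\<omega>. obs_seq \<omega> n) \<in> P \<rightarrow>\<^sub>M borel"
  "(\<lambda>\<omega>. past n (obs_seq \<omega>)) \<in> P \<rightarrow>\<^sub>M past_space n"
  "obs_seq \<in> P \<rightarrow>\<^sub>M (\<Pi>\<^sub>M i\<in>UNIV. borel)"
proof -
  show 1: "(\<lambda>\<omega>. \<omega> n) \<in> P \<rightarrow>\<^sub>M borel \<Otimes>\<^sub>M borel" for n
    by (simp add: measurable_cong_sets[OF sets_P refl] measurable_component_singleton)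
  show "state_at n \<in> P \<rightarrow>\<^sub>M borel" "(\<lambda>\<omega>. obs_seq \<omega> n) \<in> P \<rightarrow>\<^sub>M borel" for n
    using measurable_compose[OF 1 measurable_fst] measurable_compose[OF 1 measurable_snd] by auto
  then show "(\<lambda>\<omega>. past n (obs_seq \<omega>)) \<in> P \<rightarrow>\<^sub>M past_space n"
    "obs_seq \<in> P \<rightarrow>\<^sub>M (\<Pi>\<^sub>M i\<in>UNIV. borel)"
    by (auto intro!: measurable_restrict measurable_PiM_single' simp: space_PiM)
qed

lemmas [measurable] = measurable_P

text \<open>Given the earlier measurements and the current state, the current measurement has law \<open>Q\<close>. Both
  sides reduce to the same integral when the joint law of state and measurement given the full
  history is unfolded: on the right the measurement has already been integrated out.\<close>

lemma nn_integral_obs: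
  assumes F: "(\<lambda>(h, y). F h y) \<in> borel_measurable (past_space n \<Otimes>\<^sub>M borel)"
  shows "(\<integral>\<^sup>+\<omega>. F (past n (obs_seq \<omega>)) (obs_seq \<omega> n) \<partial>P) =
    (\<integral>\<^sup>+\<omega>. (\<integral>\<^sup>+y. F (past n (obs_seq \<omega>)) y \<partial>Q (state_at n \<omega>)) \<partial>P)"
proof -
  let ?S = "\<Pi>\<^sub>M i\<in>{0..<n}. (borel :: 'x measure) \<Otimes>\<^sub>M (borel :: 'y measure)"
  let ?m = "\<lambda>h. case n of 0 \<Rightarrow> \<mu> | Suc k \<Rightarrow> T (fst (h k), action \<gamma> (\<lambda>i. snd (h i)) k)"
  note [measurable] = measurable_prob_algebraD[OF Q] F
  have step: "step_kernel T Q \<mu> \<gamma> n h = state_obs Q (?m h)" for h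
    by (cases n) auto
  have m: "?m h \<in> space (prob_algebra borel)" for h
    using \<mu> measurable_space[OF T] by (cases n) (auto simp: space_pair_measure)
  have Q1: "emeasure (Q x) (space (Q x)) = 1" for x
    using measurable_space[OF Q, of x] by (auto simp: space_prob_algebra intro: prob_space.emeasure_space_1)
  have [measurable]: "(\<lambda>h. past n (\<lambda>k. snd (h k))) \<in> ?S \<rightarrow>\<^sub>M past_space n"
  proof (rule measurable_restrict)
    show "(\<lambda>h. snd (h k)) \<in> ?S \<rightarrow>\<^sub>M borel" if "k \<in> {..<n}" for k
      by (rule measurable_compose[OF measurable_component_singleton[of k "{0..<n}" "\<lambda>_. borel \<Otimes>\<^sub>M borel"] measurable_snd])
        (use that in simp)
  qed
  have po: "past n (\<lambda>k. snd (restrict \<omega> {0..<n} k)) = past n (obs_seq \<omega>)" for \<omega> :: "nat \<Rightarrow> 'x \<times> 'y"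
    by (auto simp: restrict_def)
  have mI: "(\<lambda>(h, x). \<integral>\<^sup>+y. F h y \<partial>Q x) \<in> borel_measurable (past_space n \<Otimes>\<^sub>M borel)"
    unfolding split_beta' by (rule nn_integral_measurable_subprob_algebra2[where N=borel]) measurable
  let ?F = "\<lambda>h p. F (past n (\<lambda>k. snd (h k))) (snd p)"
    and ?G = "\<lambda>h p. \<integral>\<^sup>+y. F (past n (\<lambda>k. snd (h k))) y \<partial>Q (fst p)"
  have mF: "(\<lambda>(h, p). ?F h p) \<in> borel_measurable (?S \<Otimes>\<^sub>M (borel \<Otimes>\<^sub>M borel))"
    by measurable
  have mG: "(\<lambda>(h, p). ?G h p) \<in> borel_measurable (?S \<Otimes>\<^sub>M (borel \<Otimes>\<^sub>M borel))"
    using measurable_compose[of "\<lambda>q. (past n (\<lambda>k. snd (fst q k)), fst (snd q))"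
        "?S \<Otimes>\<^sub>M (borel \<Otimes>\<^sub>M borel)", OF _ mI]
    by (simp add: split_beta')
  have mFh: "(\<lambda>p. F (past n y) (snd p)) \<in> borel_measurable (borel \<Otimes>\<^sub>M borel)" for y
    using measurable_compose[OF measurable_snd measurable_Pair2[OF F past_in_space]] by simp
  have mGh: "(\<lambda>p. \<integral>\<^sup>+z. F (past n y) z \<partial>Q (fst p)) \<in> borel_measurable (borel \<Otimes>\<^sub>M borel)" for y
    using measurable_compose[OF measurable_fst measurable_Pair2[OF mI past_in_space]] by simp
  have "(\<integral>\<^sup>+\<omega>. F (past n (obs_seq \<omega>)) (obs_seq \<omega> n) \<partial>P) =
      (\<integral>\<^sup>+\<omega>. (\<integral>\<^sup>+p. F (past n (obs_seq \<omega>)) (snd p) \<partial>state_obs Q (?m (restrict \<omega> {0..<n}))) \<partial>P)"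
    using IT.nn_integral_lim_step[OF mF] unfolding po step strategic_measure_def .
  also have "\<dots> = (\<integral>\<^sup>+\<omega>. (\<integral>\<^sup>+p. (\<integral>\<^sup>+y. F (past n (obs_seq \<omega>)) y \<partial>Q (fst p)) \<partial>state_obs Q (?m (restrict \<omega> {0..<n}))) \<partial>P)"
    by (rule nn_integral_cong) (simp only: nn_integral_state_obs[OF Q m mFh] nn_integral_state_obs[OF Q m mGh]
        fst_conv snd_conv nn_integral_const Q1 mult_1_right)
  also have "\<dots> = (\<integral>\<^sup>+\<omega>. (\<integral>\<^sup>+y. F (past n (obs_seq \<omega>)) y \<partial>Q (state_at n \<omega>)) \<partial>P)"
    using IT.nn_integral_lim_step[OF mG] unfolding po step strategic_measure_def by (rule sym)
  finally show ?thesis .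
qed

text \<open>The predictor is specified one event \<open>B\<close> at a time through conditional expectations. On
  rectangles its defining property is the one of conditional expectation on the event that the
  past measurements lie in \<open>A\<close>; the extension to functions of past and state follows.\<close>

lemma nn_integral_predictor:
  assumes \<pi>: "predictor T Q \<mu> \<gamma> \<pi>" and n: "1 \<le> n"
    and G: "(\<lambda>(h, x). G h x) \<in> borel_measurable (past_space n \<Otimes>\<^sub>M borel)"
  shows "(\<integral>\<^sup>+\<omega>. G (past n (obs_seq \<omega>)) (state_at n \<omega>) \<partial>P) =
    (\<integral>\<^sup>+\<omega>. (\<integral>\<^sup>+x. G (past n (obs_seq \<omega>)) x \<partial>\<pi> n (past n (obs_seq \<omega>))) \<partial>P)"
proof (rule nn_integral_kernel_from_rectangles[OF P.prob_space_axioms _ _ _ _ G])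
  let ?A = "past_obs_algebra n :: (nat \<Rightarrow> 'x \<times> 'y) measure"
  have sub: "subalgebra P ?A"
    by (rule subalgebra_past_obs_algebra[OF T Q \<mu> \<gamma>])
  interpret finite_measure_subalgebra P ?A
    by unfold_locales (rule sub)
  show k: "\<pi> n \<in> past_space n \<rightarrow>\<^sub>M prob_algebra borel"
    by (rule predictor_measurable[OF \<pi> n])
  note [measurable] = measurable_prob_algebraD[OF k]
  have pk: "prob_space (\<pi> n (past n y))" for y
    using measurable_space[OF k past_in_space] by (simp add: space_prob_algebra)
  have spP: "space P = UNIV"
    using sets_eq_imp_space_eq[OF sets_P] by (simp add: space_PiM space_pair_measure)
  fix A :: "(nat \<Rightarrow> 'y) set" and B :: "'x set"
  assume [measurable]: "A \<in> sets (past_space n)" "B \<in> sets borel"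
  let ?Y = "\<lambda>\<omega>. past n (obs_seq \<omega>)"
  let ?E = "{\<omega>. ?Y \<omega> \<in> A}"
  have E: "?E \<in> sets ?A"
    unfolding past_obs_algebra_def
    using in_vimage_algebra[OF \<open>A \<in> sets (past_space n)\<close>, of ?Y UNIV] by (simp add: vimage_def)
  have EP[measurable]: "?E \<in> sets P"
    using E sub by (auto simp: subalgebra_def)
  have B'[measurable]: "{\<omega>. state_at n \<omega> \<in> B} \<in> sets P"
    using measurable_sets[OF measurable_P(2) \<open>B \<in> sets borel\<close>] by (simp add: vimage_def spP)
  have i: "integrable P (indicator {\<omega>. state_at n \<omega> \<in> B} :: _ \<Rightarrow> real)"
    by (rule P.integrable_const_bound[of _ 1]) (simp_all add: indicator_def)
  have mm[measurable]: "(\<lambda>\<omega>. measure (\<pi> n (?Y \<omega>)) B) \<in> borel_measurable P"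
    by measurable
  have ae: "AE \<omega> in P. measure (\<pi> n (?Y \<omega>)) B = real_cond_exp P ?A (indicator {\<omega>. state_at n \<omega> \<in> B}) \<omega>"
    using \<pi> n by (simp add: predictor_def)
  have "emeasure P {\<omega>\<in>space P. ?Y \<omega> \<in> A \<and> state_at n \<omega> \<in> B} = ennreal (measure P (?E \<inter> {\<omega>. state_at n \<omega> \<in> B}))"
    by (simp add: P.emeasure_eq_measure spP Int_def)
  also have "measure P (?E \<inter> {\<omega>. state_at n \<omega> \<in> B}) = (\<integral>\<omega>\<in>?E. indicator {\<omega>. state_at n \<omega> \<in> B} \<omega> \<partial>P)"
    by (simp add: set_lebesgue_integral_def indicator_inter_arith[symmetric])
  also have "\<dots> = (\<integral>\<omega>\<in>?E. real_cond_exp P ?A (indicator {\<omega>. state_at n \<omega> \<in> B}) \<omega> \<partial>P)"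
    by (rule real_cond_exp_intA[OF i E])
  also have "\<dots> = (\<integral>\<omega>\<in>?E. measure (\<pi> n (?Y \<omega>)) B \<partial>P)"
    unfolding set_lebesgue_integral_def
    using ae by (intro integral_cong_AE) (auto elim!: eventually_mono)
  also have "ennreal \<dots> = (\<integral>\<^sup>+\<omega>. ennreal (indicator ?E \<omega> * measure (\<pi> n (?Y \<omega>)) B) \<partial>P)"
    unfolding set_lebesgue_integral_def real_scaleR_def
    by (intro nn_integral_eq_integral[symmetric] P.integrable_const_bound[of _ 1])
      (auto simp: indicator_def prob_space.prob_le_1[OF pk])
  also have "\<dots> = (\<integral>\<^sup>+\<omega>. indicator A (?Y \<omega>) * emeasure (\<pi> n (?Y \<omega>)) B \<partial>P)"
    using prob_space.finite_measure[OF pk]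
    by (intro nn_integral_cong) (auto simp: indicator_def finite_measure.emeasure_eq_measure)
  finally show "emeasure P {\<omega>\<in>space P. ?Y \<omega> \<in> A \<and> state_at n \<omega> \<in> B} =
    (\<integral>\<^sup>+\<omega>. indicator A (?Y \<omega>) * emeasure (\<pi> n (?Y \<omega>)) B \<partial>P)" .
qed measurable

definition "obs_law = distr P (\<Pi>\<^sub>M i\<in>UNIV. borel) obs_seq"

lemma prob_space_obs_law: "prob_space obs_law"
  unfolding obs_law_def by (intro P.prob_space_distr measurable_P)

lemma sets_obs_law: "sets obs_law = sets (\<Pi>\<^sub>M i\<in>UNIV. borel)"
  by (simp add: obs_law_def)

text \<open>The current measurement is drawn from \<open>Q\<close> at a state whose law given the past measurements is the
  predictor.\<close>

lemma predictive_obs_law: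
  assumes \<pi>: "predictor T Q \<mu> \<gamma> \<pi>"
  shows "predictive 1 obs_law (\<lambda>n h. \<pi> n h \<bind> Q)"
  unfolding predictive_def
proof (intro allI impI conjI)
  fix n :: nat assume n: "1 \<le> n"
  have k: "\<pi> n \<in> past_space n \<rightarrow>\<^sub>M prob_algebra borel"
    by (rule predictor_measurable[OF \<pi> n])
  show kQ: "(\<lambda>h. \<pi> n h \<bind> Q) \<in> past_space n \<rightarrow>\<^sub>M prob_algebra borel"
    by (rule measurable_bind_prob_space[OF k Q])
  fix F :: "(nat \<Rightarrow> 'y) \<Rightarrow> 'y \<Rightarrow> ennreal"
  assume F[measurable]: "(\<lambda>(h, z). F h z) \<in> borel_measurable (past_space n \<Otimes>\<^sub>M borel)"
  note [measurable] = measurable_prob_algebraD[OF Q] measurable_prob_algebraD[OF kQ]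
  have mI: "(\<lambda>(h, x). \<integral>\<^sup>+y. F h y \<partial>Q x) \<in> borel_measurable (past_space n \<Otimes>\<^sub>M borel)"
    unfolding split_beta' by (rule nn_integral_measurable_subprob_algebra2[where N=borel]) measurable
  have [measurable]: "past n \<in> (\<Pi>\<^sub>M i\<in>UNIV. borel) \<rightarrow>\<^sub>M past_space n"
    by (intro measurable_restrict measurable_component_singleton) auto
  have [measurable]: "(\<lambda>h. \<integral>\<^sup>+z. F h z \<partial>(\<pi> n h \<bind> Q)) \<in> borel_measurable (past_space n)"
    by (rule nn_integral_measurable_subprob_algebra2[where N=borel]) measurable
  have "(\<integral>\<^sup>+y. F (past n y) (y n) \<partial>obs_law) = (\<integral>\<^sup>+\<omega>. F (past n (obs_seq \<omega>)) (obs_seq \<omega> n) \<partial>P)"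
    unfolding obs_law_def by (subst nn_integral_distr) auto
  also have "\<dots> = (\<integral>\<^sup>+\<omega>. (\<integral>\<^sup>+y. F (past n (obs_seq \<omega>)) y \<partial>Q (state_at n \<omega>)) \<partial>P)"
    by (rule nn_integral_obs[OF F])
  also have "\<dots> = (\<integral>\<^sup>+\<omega>. (\<integral>\<^sup>+x. (\<integral>\<^sup>+y. F (past n (obs_seq \<omega>)) y \<partial>Q x) \<partial>\<pi> n (past n (obs_seq \<omega>))) \<partial>P)"
    by (rule nn_integral_predictor[OF \<pi> n mI])
  also have "\<dots> = (\<integral>\<^sup>+\<omega>. (\<integral>\<^sup>+y. F (past n (obs_seq \<omega>)) y \<partial>(\<pi> n (past n (obs_seq \<omega>)) \<bind> Q)) \<partial>P)"
  proof (intro nn_integral_cong nn_integral_bind[symmetric])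
    fix \<omega> :: "nat \<Rightarrow> 'x \<times> 'y"
    show "F (past n (obs_seq \<omega>)) \<in> borel_measurable borel"
      using measurable_Pair2[OF F past_in_space] by simp
    have "sets (\<pi> n (past n (obs_seq \<omega>))) = sets borel"
      using measurable_space[OF k past_in_space] by (simp add: space_prob_algebra)
    then show "Q \<in> \<pi> n (past n (obs_seq \<omega>)) \<rightarrow>\<^sub>M subprob_algebra borel"
      using measurable_prob_algebraD[OF Q] by (simp cong: measurable_cong_sets)
  qed
  also have "\<dots> = (\<integral>\<^sup>+y. (\<integral>\<^sup>+z. F (past n y) z \<partial>(\<pi> n (past n y) \<bind> Q)) \<partial>obs_law)"
    unfolding obs_law_def by (subst nn_integral_distr) auto
  finally show "(\<integral>\<^sup>+y. F (past n y) (y n) \<partial>obs_law) =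
    (\<integral>\<^sup>+y. (\<integral>\<^sup>+z. F (past n y) z \<partial>(\<pi> n (past n y) \<bind> Q)) \<partial>obs_law)" .
qed

end

section \<open>Absolute continuity of the measurement laws\<close>

lemma state_obs_density:
  fixes Q :: "'x::topological_space \<Rightarrow> 'y::topological_space measure"
  assumes Q: "Q \<in> borel \<rightarrow>\<^sub>M prob_algebra borel"
    and \<mu>: "\<mu> \<in> space (prob_algebra borel)" and \<nu>: "\<nu> \<in> space (prob_algebra borel)"
    and r[measurable]: "r \<in> borel_measurable borel" and d: "\<mu> = density \<nu> r"
  shows "state_obs Q \<mu> = density (state_obs Q \<nu>) (\<lambda>p. r (fst p))"
proof (rule measure_eqI)
  note so = measurable_space[OF measurable_state_obs[OF Q]]
  have s: "sets (state_obs Q \<mu>) = sets (borel \<Otimes>\<^sub>M borel)" "sets (state_obs Q \<nu>) = sets (borel \<Otimes>\<^sub>M borel)"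
    using so[OF \<mu>] so[OF \<nu>] by (auto simp: space_prob_algebra)
  then show "sets (state_obs Q \<mu>) = sets (density (state_obs Q \<nu>) (\<lambda>p. r (fst p)))" by simp
  have sn[measurable_cong]: "sets \<nu> = sets borel" "sets (Q x) = sets borel" for x
    using \<nu> measurable_space[OF Q, of x] by (auto simp: space_prob_algebra)
  note [measurable] = measurable_prob_algebraD[OF Q]
  fix A assume "A \<in> sets (state_obs Q \<mu>)"
  then have A[measurable]: "A \<in> sets (borel \<Otimes>\<^sub>M borel)" by (simp add: s)
  have mI[measurable]: "(\<lambda>x. \<integral>\<^sup>+y. indicator A (x, y) \<partial>Q x) \<in> borel_measurable borel"
    by (rule nn_integral_measurable_subprob_algebra2[where N=borel]) measurable
  have "emeasure (state_obs Q \<mu>) A = (\<integral>\<^sup>+p. indicator A p \<partial>state_obs Q \<mu>)"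
    using A s by simp
  also have "\<dots> = (\<integral>\<^sup>+x. r x * (\<integral>\<^sup>+y. indicator A (x, y) \<partial>Q x) \<partial>\<nu>)"
    unfolding nn_integral_state_obs[OF Q \<mu> borel_measurable_indicator[OF A]] unfolding d
    by (rule nn_integral_density) measurable
  also have "\<dots> = (\<integral>\<^sup>+x. (\<integral>\<^sup>+y. r (fst (x, y)) * indicator A (x, y) \<partial>Q x) \<partial>\<nu>)"
    by (intro nn_integral_cong) (simp add: nn_integral_cmult)
  also have "\<dots> = (\<integral>\<^sup>+p. r (fst p) * indicator A p \<partial>state_obs Q \<nu>)"
    by (rule nn_integral_state_obs[OF Q \<nu>, symmetric]) measurable
  also have "\<dots> = emeasure (density (state_obs Q \<nu>) (\<lambda>p. r (fst p))) A"
    using A s by (intro emeasure_density[symmetric]) (auto cong: measurable_cong_sets)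
  finally show "emeasure (state_obs Q \<mu>) A = emeasure (density (state_obs Q \<nu>) (\<lambda>p. r (fst p))) A" .
qed

lemma strategic_measure_density:
  fixes T :: "'x::topological_space \<times> 'u::topological_space \<Rightarrow> 'x measure"
    and Q :: "'x \<Rightarrow> 'y::topological_space measure"
  assumes T: "T \<in> borel \<Otimes>\<^sub>M borel \<rightarrow>\<^sub>M prob_algebra borel"
    and Q: "Q \<in> borel \<rightarrow>\<^sub>M prob_algebra borel"
    and \<mu>: "\<mu> \<in> space (prob_algebra borel)" and \<nu>: "\<nu> \<in> space (prob_algebra borel)"
    and \<gamma>: "\<gamma> \<in> admissible"
    and r[measurable]: "r \<in> borel_measurable borel" and d: "\<mu> = density \<nu> r"
  shows "strategic_measure T Q \<mu> \<gamma> = density (strategic_measure T Q \<nu> \<gamma>) (\<lambda>\<omega>. r (state_at 0 \<omega>))"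
  unfolding strategic_measure_def
proof (rule Ionescu_Tulcea_lim_density[where r = "\<lambda>p. r (fst p)"])
  show "step_kernel T Q \<mu> \<gamma> 0 (\<lambda>_. undefined) = density (step_kernel T Q \<nu> \<gamma> 0 (\<lambda>_. undefined)) (\<lambda>p. r (fst p))"
    using state_obs_density[OF Q \<mu> \<nu> r d] by simp
  show "step_kernel T Q \<mu> \<gamma> n h = step_kernel T Q \<nu> \<gamma> n h" if "0 < n" for n h
    using that by (cases n) auto
qed (use assms in \<open>auto intro!: Ionescu_Tulcea_step_kernel\<close>)

lemma absolutely_continuous_obs_law:
  fixes T :: "'x::topological_space \<times> 'u::topological_space \<Rightarrow> 'x measure"
    and Q :: "'x \<Rightarrow> 'y::topological_space measure"
  assumes T: "T \<in> borel \<Otimes>\<^sub>M borel \<rightarrow>\<^sub>M prob_algebra borel"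
    and Q: "Q \<in> borel \<rightarrow>\<^sub>M prob_algebra borel"
    and \<mu>: "\<mu> \<in> space (prob_algebra borel)" and \<nu>: "\<nu> \<in> space (prob_algebra borel)"
    and \<gamma>: "\<gamma> \<in> admissible" and ac: "absolutely_continuous \<nu> \<mu>"
  shows "absolutely_continuous (distr (strategic_measure T Q \<nu> \<gamma>) (\<Pi>\<^sub>M i\<in>UNIV. borel) obs_seq)
    (distr (strategic_measure T Q \<mu> \<gamma>) (\<Pi>\<^sub>M i\<in>UNIV. borel) obs_seq)"
  unfolding absolutely_continuous_def
proof
  interpret m: controlled_process T Q \<mu> \<gamma> by unfold_locales fact+
  interpret n: controlled_process T Q \<nu> \<gamma> by unfold_locales fact+
  have s: "sets \<mu> = sets borel" "sets \<nu> = sets borel" and p: "prob_space \<nu>"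
    using \<mu> \<nu> by (auto simp: space_prob_algebra)
  interpret prob_space \<nu> by fact
  have r[measurable]: "RN_deriv \<nu> \<mu> \<in> borel_measurable borel"
    using borel_measurable_RN_deriv[of \<nu> \<mu>] by (simp add: measurable_cong_sets[OF s(2) refl])
  have "\<mu> = density \<nu> (RN_deriv \<nu> \<mu>)"
    using density_RN_deriv[OF ac] s by simp
  note d = strategic_measure_density[OF T Q \<mu> \<nu> \<gamma> r this]
  fix A assume "A \<in> null_sets (distr n.P (\<Pi>\<^sub>M i\<in>UNIV. borel) obs_seq)"
  then have A: "A \<in> sets (\<Pi>\<^sub>M i\<in>UNIV. borel)" "obs_seq -` A \<inter> space n.P \<in> null_sets n.P"
    by (auto simp: null_sets_distr_iff)
  have "space m.P = space n.P"
    using m.sets_P n.sets_P by (metis sets_eq_imp_space_eq)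
  moreover have "obs_seq -` A \<inter> space n.P \<in> null_sets m.P"
    using absolutely_continuousI_density[of "\<lambda>\<omega>. RN_deriv \<nu> \<mu> (state_at 0 \<omega>)" n.P] A(2)
    unfolding d absolutely_continuous_def by auto
  ultimately show "A \<in> null_sets (distr m.P (\<Pi>\<^sub>M i\<in>UNIV. borel) obs_seq)"
    using A(1) by (auto simp: null_sets_distr_iff)
qed


section \<open>Weak merging of the predictors\<close>

lemma observation_integral_approx:
  fixes Q :: "'x::topological_space \<Rightarrow> 'y::topological_space measure" and f :: "'x \<Rightarrow> real" and g :: "'y \<Rightarrow> real"
  assumes Q: "Q \<in> borel \<rightarrow>\<^sub>M prob_algebra borel" and m: "m \<in> space (prob_algebra borel)"
    and f: "f \<in> borel_measurable borel" "bounded (range f)"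
    and g: "g \<in> borel_measurable borel" "bounded (range g)"
    and fg: "\<And>x. \<bar>f x - (\<integral>y. g y \<partial>Q x)\<bar> \<le> e"
  shows "\<bar>(\<integral>x. f x \<partial>m) - (\<integral>z. g z \<partial>(m \<bind> Q))\<bar> \<le> e"
proof -
  have sm[measurable_cong]: "sets m = sets borel" and "prob_space m"
    using m by (auto simp: space_prob_algebra)
  interpret prob_space m by fact
  have Qx: "prob_space (Q x)" "sets (Q x) = sets borel" for x
    using measurable_space[OF Q, of x] by (auto simp: space_prob_algebra)
  have Qm: "Q \<in> m \<rightarrow>\<^sub>M subprob_algebra borel"
    using measurable_prob_algebraD[OF Q] by (simp add: measurable_cong_sets[OF sm refl])
  obtain C where C: "\<And>z. \<bar>g z\<bar> \<le> C"
    using g(2) by (auto simp: bounded_iff)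
  obtain D where D: "\<And>x. \<bar>f x\<bar> \<le> D"
    using f(2) by (auto simp: bounded_iff)
  have "(\<integral>z. g z \<partial>(m \<bind> Q)) = (\<integral>x. (\<integral>y. g y \<partial>Q x) \<partial>m)"
    by (rule integral_bind[OF g(1) C Qm finite_measure_axioms, of 1])
      (simp add: prob_space.emeasure_space_1[OF Qx(1)])
  moreover have "integrable m f"
    using D f(1) by (intro integrable_const_bound[of _ D]) auto
  moreover have "integrable m (\<lambda>x. \<integral>y. g y \<partial>Q x)"
  proof (rule integrable_const_bound[of _ "D + e"])
    show "AE x in m. norm (\<integral>y. g y \<partial>Q x) \<le> D + e"
    proof (rule AE_I2)
      fix x show "norm (\<integral>y. g y \<partial>Q x) \<le> D + e"
        using fg[of x] D[of x] by simp
    qed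
    show "(\<lambda>x. \<integral>y. g y \<partial>Q x) \<in> borel_measurable m"
      by (rule measurable_compose[OF Qm integral_measurable_subprob_algebra[OF g(1)]])
  qed
  ultimately have "(\<integral>x. f x \<partial>m) - (\<integral>z. g z \<partial>(m \<bind> Q)) = (\<integral>x. f x - (\<integral>y. g y \<partial>Q x) \<partial>m)"
      and i: "integrable m (\<lambda>x. f x - (\<integral>y. g y \<partial>Q x))"
    by simp_all
  then have "\<bar>(\<integral>x. f x \<partial>m) - (\<integral>z. g z \<partial>(m \<bind> Q))\<bar> \<le> (\<integral>x. \<bar>f x - (\<integral>y. g y \<partial>Q x)\<bar> \<partial>m)"
    by (metis integral_abs_bound)
  also have "\<dots> \<le> e"
    using i fg by (intro integral_le_const) auto
  finally show ?thesis .
qed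

text \<open>Up to twice the accuracy of the observability approximation, the difference of the integrals of
  \<open>f\<close> is that of the integrals of \<open>g\<close> against the predictive laws, which merge.\<close>

theorem theorem3p4:
  fixes T :: "'x::polish_space \<times> 'u::polish_space \<Rightarrow> 'x measure"
    and Q :: "'x \<Rightarrow> 'y::polish_space measure"
    and \<mu> \<nu> :: "'x measure"
  assumes "sigma_compact_space TYPE('x)"
    and "T \<in> borel \<Otimes>\<^sub>M borel \<rightarrow>\<^sub>M prob_algebra borel"
    and "Q \<in> borel \<rightarrow>\<^sub>M prob_algebra borel"
    and "\<mu> \<in> space (prob_algebra borel)"
    and "\<nu> \<in> space (prob_algebra borel)"
    and "absolutely_continuous \<nu> \<mu>"
    and "one_step_observable Q"
  shows "\<forall>\<gamma>\<in>admissible. predictor_merges_weakly_as T Q \<mu> \<nu> \<gamma>"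
proof
  fix \<gamma> :: "('y, 'u) policy" assume \<gamma>: "\<gamma> \<in> admissible"
  interpret m: controlled_process T Q \<mu> \<gamma> by unfold_locales fact+
  interpret n: controlled_process T Q \<nu> \<gamma> by unfold_locales fact+
  show "predictor_merges_weakly_as T Q \<mu> \<nu> \<gamma>"
    unfolding predictor_merges_weakly_as_def
  proof (intro allI impI)
    fix \<pi>\<mu> \<pi>\<nu> :: "nat \<Rightarrow> (nat \<Rightarrow> 'y) \<Rightarrow> 'x measure"
    assume \<pi>: "predictor T Q \<mu> \<gamma> \<pi>\<mu>" "predictor T Q \<nu> \<gamma> \<pi>\<nu>"
    interpret predictive_pair m.obs_law n.obs_law "\<lambda>n h. \<pi>\<mu> n h \<bind> Q" "\<lambda>n h. \<pi>\<nu> n h \<bind> Q" 1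
    proof (rule predictive_pair.intro)
      show "absolutely_continuous n.obs_law m.obs_law"
        unfolding m.obs_law_def n.obs_law_def
        by (rule absolutely_continuous_obs_law) fact+
      show "predictive 1 m.obs_law (\<lambda>n h. \<pi>\<mu> n h \<bind> Q)" "predictive 1 n.obs_law (\<lambda>n h. \<pi>\<nu> n h \<bind> Q)"
        by (rule m.predictive_obs_law[OF \<pi>(1)], rule n.predictive_obs_law[OF \<pi>(2)])
    qed (rule m.prob_space_obs_law m.sets_obs_law n.prob_space_obs_law n.sets_obs_law)+
    let ?good = "\<lambda>y. \<forall>g\<in>borel_measurable borel. bounded (range g) \<longrightarrow>
      (\<lambda>n. (\<integral>z. g z \<partial>(\<pi>\<mu> n (past n y) \<bind> Q)) - (\<integral>z. g z \<partial>(\<pi>\<nu> n (past n y) \<bind> Q))) \<longlonglongrightarrow> (0::real)"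
    obtain N where N: "{y\<in>space m.obs_law. \<not> ?good y} \<subseteq> N" "emeasure m.obs_law N = 0" "N \<in> sets m.obs_law"
      using AE_predictive_merge by (rule AE_E)
    define A where "A = space m.obs_law - N"
    have "A \<in> sets (\<Pi>\<^sub>M i\<in>UNIV. borel)"
      using N(3) W(2) unfolding A_def by (metis sets.compl_sets)
    moreover have "measure m.obs_law A = 1"
      unfolding A_def W.prob_compl[OF N(3)] by (simp add: measure_def N(2))
    moreover have "(\<lambda>n. \<bar>(\<integral>x. f x \<partial>\<pi>\<mu> n (past n y)) - (\<integral>x. f x \<partial>\<pi>\<nu> n (past n y))\<bar>) \<longlonglongrightarrow> 0"
      if y: "y \<in> A" and f: "f \<in> bcontfun" for y and f :: "'x \<Rightarrow> real"
    proof (rule LIMSEQ_I)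
      fix r :: real assume r: "0 < r"
      \<comment> \<open>Accuracy \<open>r / 4\<close> for each predictor leaves \<open>r / 2\<close> for the predictive laws.\<close>
      obtain g :: "'y \<Rightarrow> real" where g: "g \<in> borel_measurable borel" "bounded (range g)"
          "(SUP x. ereal \<bar>f x - (\<integral>y. g y \<partial>Q x)\<bar>) < ereal (r / 4)"
        using assms(7) f r unfolding one_step_observable_def by (meson divide_pos_pos zero_less_numeral)
      have fg: "\<bar>f x - (\<integral>y. g y \<partial>Q x)\<bar> \<le> r / 4" for x
        using SUP_lessD[OF g(3), of x] by simp
      have approx: "\<bar>(\<integral>x. f x \<partial>m) - (\<integral>z. g z \<partial>(m \<bind> Q))\<bar> \<le> r / 4" if m: "m \<in> space (prob_algebra borel)" for m
        using observation_integral_approx[OF assms(3) m _ _ g(1,2) fg] f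
        by (auto simp: bcontfun_def intro: borel_measurable_continuous_onI)
      have "?good y"
        using y N(1) by (auto simp: A_def)
      then have "(\<lambda>n. (\<integral>z. g z \<partial>(\<pi>\<mu> n (past n y) \<bind> Q)) - (\<integral>z. g z \<partial>(\<pi>\<nu> n (past n y) \<bind> Q))) \<longlonglongrightarrow> 0"
        using g by blast
      from LIMSEQ_D[OF this, of "r / 2"] r obtain n\<^sub>1 where n1: "\<And>n. n\<^sub>1 \<le> n \<Longrightarrow>
          \<bar>(\<integral>z. g z \<partial>(\<pi>\<mu> n (past n y) \<bind> Q)) - (\<integral>z. g z \<partial>(\<pi>\<nu> n (past n y) \<bind> Q))\<bar> < r / 2"
        by auto
      have "\<bar>(\<integral>x. f x \<partial>\<pi>\<mu> n (past n y)) - (\<integral>x. f x \<partial>\<pi>\<nu> n (past n y))\<bar> < r" if n: "max 1 n\<^sub>1 \<le> n" for n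
      proof -
        have "1 \<le> n" using n by simp
        then have "\<pi>\<mu> n (past n y) \<in> space (prob_algebra borel)" "\<pi>\<nu> n (past n y) \<in> space (prob_algebra borel)"
          by (rule measurable_space[OF predictor_measurable[OF \<pi>(1)] past_in_space],
              rule measurable_space[OF predictor_measurable[OF \<pi>(2)] past_in_space])
        from approx[OF this(1)] approx[OF this(2)] n1[of n] n show ?thesis
          by linarith
      qed
      then show "\<exists>no. \<forall>n\<ge>no. norm (\<bar>(\<integral>x. f x \<partial>\<pi>\<mu> n (past n y)) - (\<integral>x. f x \<partial>\<pi>\<nu> n (past n y))\<bar> - 0) < r"
        by (intro exI[of _ "max 1 n\<^sub>1"]) simp
    qed
    ultimately show "\<exists>A\<in>sets (\<Pi>\<^sub>M i\<in>UNIV. borel).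
      measure (distr (strategic_measure T Q \<mu> \<gamma>) (\<Pi>\<^sub>M i\<in>UNIV. borel) obs_seq) A = 1 \<and>
      (\<forall>y\<in>A. \<forall>f :: 'x \<Rightarrow> real. f \<in> bcontfun \<longrightarrow>
        (\<lambda>n. \<bar>(\<integral>x. f x \<partial>\<pi>\<mu> n (past n y)) - (\<integral>x. f x \<partial>\<pi>\<nu> n (past n y))\<bar>) \<longlonglongrightarrow> 0)"
      unfolding m.obs_law_def by blast
  qed
qed

end
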